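(* Let $(M,J,g)$ and $(N,J^N,h)$ be almost Hermitian manifolds and let $u:M\to N$ be a smooth map that is holomorphic, i.e. $\mathrm{d}u\circ J=J^N\circ \mathrm{d}u$. Then $u$ is Hermitian pluriharmonic.
   Context: An almost Hermitian manifold $(M,J,g)$ is an almost complex manifold $(M,J)$ (so $J^2=-\mathrm{id}$; $J$ is not assumed integrable) with a Riemannian metric $g=\langle\cdot,\cdot\rangle$ such that $g(JX,JY)=g(X,Y)$. $\nabla$ denotes its Levi-Civita connection. The second canonical connection $\widetilde\nabla$ of $(M,J,g)$ is the connection defined by $$\langle \widetilde\nabla_XY,Z\rangle=\langle\nabla_XY,Z\rangle-\tfrac12\langle J(\nabla_XJ)Y,Z\rangle+\tfrac14\{\langle X,(\nabla_{JY}J)Z+J(\nabla_YJ)Z\rangle-\langle X,(\nabla_{JZ}J)Y+J(\nabla_ZJ)Y\rangle\}$$ for $X,Y,Z\in\Gamma(TM)$. It is the unique connection with $\widetilde\nabla g=0$, $\widetilde\nabla J=0$ and vanishing $J$-invariant ($(1,1)$) part of the torsion. $\widetilde\nabla^N$ denotes the second canonical connection of $(N,J^N,h)$. For a smooth map $u:M\to N$ put $\widetilde\nabla \mathrm{d}u(X,Y)=\widetilde\nabla^N_{\mathrm{d}u(X)}(\mathrm{d}u(Y))-\mathrm{d}u(\widetilde\nabla_XY)$ (the first term using the connection induced on $u^{-1}TN$), extended complex bilinearly to $TM\otimes\mathbb{C}$. The map $u$ is called Hermitian pluriharmonic if $\widetilde\nabla \mathrm{d}u(Z,\overline W)=0$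 for all $Z,W\in\Gamma(T^{1,0}M)$, where $T^{1,0}M=\{X-\sqrt{-1}JX: X\in TM\}$; equivalently, $\widetilde\nabla \mathrm{d}u(X,Y)+\widetilde\nabla \mathrm{d}u(JX,JY)=0$ for all $X,Y\in\Gamma(TM)$. *)

theory Defs
  imports "HOL-Analysis.Analysis" "HOL-Library.Function_Algebras"
begin

section \<open>Smooth manifolds\<close>

text \<open>\<open>C\<^sup>k\<close> and \<open>C\<^sup>\<infinity>\<close> maps. These notions are only used on open sets of Euclidean spaces,
  where asking all iterated directional derivatives to exist and be continuous is the usual notion.\<close>

fun Ck_on :: "nat \<Rightarrow> 'a::euclidean_space set \<Rightarrow> ('a \<Rightarrow> 'b::euclidean_space) \<Rightarrow> bool" where
  "Ck_on 0 S f \<longleftrightarrow> continuous_on S f"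
| "Ck_on (Suc k) S f \<longleftrightarrow>
     (\<forall>x\<in>S. f differentiable (at x)) \<and> (\<forall>v. Ck_on k S (\<lambda>x. frechet_derivative f (at x) v))"

definition smooth_on :: "'a::euclidean_space set \<Rightarrow> ('a \<Rightarrow> 'b::euclidean_space) \<Rightarrow> bool" where
  "smooth_on S f \<longleftrightarrow> (\<forall>k. Ck_on k S f)"

text \<open>A chart is a domain together with a coordinate map; the map is arbitrary outside the domain.
  The atlas is not required to be maximal.\<close>

type_synonym ('m, 'a) chart = "'m set \<times> ('m \<Rightarrow> 'a)"

record ('m, 'a) manifold =
  mtop :: "'m topology"
  atlas :: "('m, 'a) chart set"

abbreviation points :: "('m, 'a) manifold \<Rightarrow> 'm set" where
  "points M \<equiv> topspace (mtop M)"

definition charts_at :: "('m, 'a) manifold \<Rightarrow> 'm \<Rightarrow> ('m, 'a) chart set" where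
  "charts_at M p = {c \<in> atlas M. p \<in> fst c}"

definition chart_inv :: "('m, 'a) chart \<Rightarrow> 'a \<Rightarrow> 'm" where
  "chart_inv c = inv_into (fst c) (snd c)"

definition transition :: "('m, 'a) chart \<Rightarrow> ('m, 'a) chart \<Rightarrow> 'a \<Rightarrow> 'a" where
  "transition c d = (\<lambda>x. snd d (chart_inv c x))"

definition smooth_manifold :: "('m, 'a::euclidean_space) manifold \<Rightarrow> bool" where
  "smooth_manifold M \<longleftrightarrow>
     Hausdorff_space (mtop M) \<and> second_countable (mtop M) \<and>
     (\<Union>c\<in>atlas M. fst c) = points M \<and>
     (\<forall>c\<in>atlas M. openin (mtop M) (fst c) \<and> open (snd c ` fst c) \<and>
        homeomorphic_map (subtopology (mtop M) (fst c)) (top_of_set (snd c ` fst c)) (snd c)) \<and>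
     (\<forall>c\<in>atlas M. \<forall>d\<in>atlas M. smooth_on (snd c ` (fst c \<inter> fst d)) (transition c d))"

definition smooth_function :: "('m, 'a::euclidean_space) manifold \<Rightarrow> 'm set \<Rightarrow> ('m \<Rightarrow> real) \<Rightarrow> bool" where
  "smooth_function M W f \<longleftrightarrow> (\<forall>c\<in>atlas M. smooth_on (snd c ` (fst c \<inter> W)) (\<lambda>x. f (chart_inv c x)))"

definition smooth_map ::
  "('m, 'a::euclidean_space) manifold \<Rightarrow> ('n, 'b::euclidean_space) manifold \<Rightarrow> ('m \<Rightarrow> 'n) \<Rightarrow> bool" where
  "smooth_map M N u \<longleftrightarrow> continuous_map (mtop M) (mtop N) u \<and>
     (\<forall>c\<in>atlas M. \<forall>d\<in>atlas N.
        smooth_on (snd c ` (fst c \<inter> u -` fst d)) (\<lambda>x. snd d (u (chart_inv c x))))"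

section \<open>Tangent vectors and sections\<close>

text \<open>A tangent vector at \<open>p\<close> is the family of its coordinate vectors in all charts around \<open>p\<close>,
  subject to the usual transformation rule. At the other indices the family is \<open>0\<close>, so that
  equality of tangent vectors is equality of functions. The vector space operations
  are pointwise.\<close>

type_synonym ('m, 'a) tvec = "('m, 'a) chart \<Rightarrow> 'a"

definition tscale :: "real \<Rightarrow> ('m, 'a::real_vector) tvec \<Rightarrow> ('m, 'a) tvec" where
  "tscale r v = (\<lambda>c. r *\<^sub>R v c)"

definition tangent_space :: "('m, 'a::euclidean_space) manifold \<Rightarrow> 'm \<Rightarrow> ('m, 'a) tvec set" where
  "tangent_space M p = {v.
     (\<forall>c\<in>charts_at M p. \<forall>d\<in>charts_at M p.
        v d = frechet_derivative (transition c d) (at (snd c p)) (v c)) \<and>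
     (\<forall>c. c \<notin> charts_at M p \<longrightarrow> v c = 0)}"

text \<open>Derivatives at \<open>p\<close> of functions and maps are computed in some chart at \<open>p\<close>; the result does
  not depend on that chart.\<close>

definition chart_at :: "('m, 'a) manifold \<Rightarrow> 'm \<Rightarrow> ('m, 'a) chart" where
  "chart_at M p = (SOME c. c \<in> charts_at M p)"

definition dir_deriv ::
  "('m, 'a::euclidean_space) manifold \<Rightarrow> 'm \<Rightarrow> ('m, 'a) tvec \<Rightarrow> ('m \<Rightarrow> real) \<Rightarrow> real" where
  "dir_deriv M p v f = (let c = chart_at M p in
     frechet_derivative (\<lambda>x. f (chart_inv c x)) (at (snd c p)) (v c))"

definition differential ::
  "('m, 'a::euclidean_space) manifold \<Rightarrow> ('n, 'b::euclidean_space) manifold \<Rightarrow> ('m \<Rightarrow> 'n)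
     \<Rightarrow> 'm \<Rightarrow> ('m, 'a) tvec \<Rightarrow> ('n, 'b) tvec" where
  "differential M N u p v = (\<lambda>d. let c = chart_at M p in
     if d \<in> charts_at N (u p)
     then frechet_derivative (\<lambda>x. snd d (u (chart_inv c x))) (at (snd c p)) (v c) else 0)"

text \<open>\<open>section_along M N u W s\<close>: over the open set \<open>W\<close> of \<open>M\<close>, \<open>s\<close> is a smooth section of
  the pullback bundle \<open>u\<^sup>-\<^sup>1TN\<close>. The values of \<open>s\<close> outside \<open>W\<close> are irrelevant.
  For \<open>u = id\<close> this is a smooth vector field on \<open>W\<close>.\<close>

definition section_along ::
  "('m, 'a::euclidean_space) manifold \<Rightarrow> ('n, 'b::euclidean_space) manifold \<Rightarrow> ('m \<Rightarrow> 'n)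
     \<Rightarrow> 'm set \<Rightarrow> ('m \<Rightarrow> ('n, 'b) tvec) \<Rightarrow> bool" where
  "section_along M N u W s \<longleftrightarrow>
     (\<forall>p\<in>W. s p \<in> tangent_space N (u p)) \<and>
     (\<forall>c\<in>atlas M. \<forall>d\<in>atlas N.
        smooth_on (snd c ` (fst c \<inter> W \<inter> u -` fst d)) (\<lambda>x. s (chart_inv c x) d))"

abbreviation vector_field ::
  "('m, 'a::euclidean_space) manifold \<Rightarrow> 'm set \<Rightarrow> ('m \<Rightarrow> ('m, 'a) tvec) \<Rightarrow> bool" where
  "vector_field M \<equiv> section_along M M id"

definition lie_bracket ::
  "('m, 'a::euclidean_space) manifold \<Rightarrow> ('m \<Rightarrow> ('m, 'a) tvec) \<Rightarrow> ('m \<Rightarrow> ('m, 'a) tvec)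
     \<Rightarrow> 'm \<Rightarrow> ('m, 'a) tvec" where
  "lie_bracket M X Y p = (\<lambda>c. if c \<in> charts_at M p
     then frechet_derivative (\<lambda>x. Y (chart_inv c x) c) (at (snd c p)) (X p c)
        - frechet_derivative (\<lambda>x. X (chart_inv c x) c) (at (snd c p)) (Y p c)
     else 0)"

section \<open>Almost Hermitian manifolds\<close>

type_synonym ('m, 'a) endo_field = "'m \<Rightarrow> ('m, 'a) tvec \<Rightarrow> ('m, 'a) tvec"
type_synonym ('m, 'a) form_field = "'m \<Rightarrow> ('m, 'a) tvec \<Rightarrow> ('m, 'a) tvec \<Rightarrow> real"

definition almost_complex_structure ::
  "('m, 'a::euclidean_space) manifold \<Rightarrow> ('m, 'a) endo_field \<Rightarrow> bool" where
  "almost_complex_structure M J \<longleftrightarrow>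
     (\<forall>p\<in>points M. \<forall>v\<in>tangent_space M p.
        J p v \<in> tangent_space M p \<and> J p (J p v) = - v \<and>
        (\<forall>r. J p (tscale r v) = tscale r (J p v)) \<and>
        (\<forall>w\<in>tangent_space M p. J p (v + w) = J p v + J p w)) \<and>
     (\<forall>W X. openin (mtop M) W \<longrightarrow> vector_field M W X \<longrightarrow> vector_field M W (\<lambda>p. J p (X p)))"

definition riemannian_metric ::
  "('m, 'a::euclidean_space) manifold \<Rightarrow> ('m, 'a) form_field \<Rightarrow> bool" where
  "riemannian_metric M g \<longleftrightarrow>
     (\<forall>p\<in>points M. \<forall>v\<in>tangent_space M p.
        (v \<noteq> 0 \<longrightarrow> g p v v > 0) \<and>
        (\<forall>w\<in>tangent_space M p. g p v w = g p w v \<and> (\<forall>r. g p (tscale r v) w = r * g p v w) \<and>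
           (\<forall>z\<in>tangent_space M p. g p (v + z) w = g p v w + g p z w))) \<and>
     (\<forall>W X Y. openin (mtop M) W \<longrightarrow> vector_field M W X \<longrightarrow> vector_field M W Y \<longrightarrow>
        smooth_function M W (\<lambda>p. g p (X p) (Y p)))"

definition almost_hermitian_manifold ::
  "('m, 'a::euclidean_space) manifold \<Rightarrow> ('m, 'a) endo_field \<Rightarrow> ('m, 'a) form_field \<Rightarrow> bool" where
  "almost_hermitian_manifold M J g \<longleftrightarrow>
     smooth_manifold M \<and> almost_complex_structure M J \<and> riemannian_metric M g \<and>
     (\<forall>p\<in>points M. \<forall>v\<in>tangent_space M p. \<forall>w\<in>tangent_space M p. g p (J p v) (J p w) = g p v w)"

text \<open>Only used for smooth maps \<open>u\<close>.\<close>

definition holomorphic_map ::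
  "('m, 'a::euclidean_space) manifold \<Rightarrow> ('m, 'a) endo_field \<Rightarrow>
   ('n, 'b::euclidean_space) manifold \<Rightarrow> ('n, 'b) endo_field \<Rightarrow> ('m \<Rightarrow> 'n) \<Rightarrow> bool" where
  "holomorphic_map M J N J' u \<longleftrightarrow>
     (\<forall>p\<in>points M. \<forall>v\<in>tangent_space M p.
        differential M N u p (J p v) = J' (u p) (differential M N u p v))"

section \<open>Connections\<close>

text \<open>\<open>D p v s\<close> is the derivative at \<open>p\<close> in direction \<open>v\<close> of a section \<open>s\<close> of \<open>u\<^sup>-\<^sup>1TN\<close> defined
  near \<open>p\<close>. Sections over arbitrary open sets are admitted; since they are represented by total
  functions, the locality clause says that only the germ of \<open>s\<close> at \<open>p\<close> matters.\<close>

type_synonym ('m, 'a, 'n, 'b) conn_along =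
  "'m \<Rightarrow> ('m, 'a) tvec \<Rightarrow> ('m \<Rightarrow> ('n, 'b) tvec) \<Rightarrow> ('n, 'b) tvec"

type_synonym ('m, 'a) conn = "('m, 'a, 'm, 'a) conn_along"

definition connection_along ::
  "('m, 'a::euclidean_space) manifold \<Rightarrow> ('n, 'b::euclidean_space) manifold \<Rightarrow> ('m \<Rightarrow> 'n)
     \<Rightarrow> ('m, 'a, 'n, 'b) conn_along \<Rightarrow> bool" where
  "connection_along M N u D \<longleftrightarrow>
     (\<forall>W s. openin (mtop M) W \<longrightarrow> section_along M N u W s \<longrightarrow>
        (\<forall>p\<in>W. \<forall>v\<in>tangent_space M p.
           D p v s \<in> tangent_space N (u p) \<and>
           (\<forall>r. D p (tscale r v) s = tscale r (D p v s)) \<and>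
           (\<forall>w\<in>tangent_space M p. D p (v + w) s = D p v s + D p w s) \<and>
           (\<forall>t. section_along M N u W t \<longrightarrow>
              D p v (\<lambda>q. s q + t q) = D p v s + D p v t \<and>
              ((\<forall>q\<in>W. s q = t q) \<longrightarrow> D p v s = D p v t)) \<and>
           (\<forall>f. smooth_function M W f \<longrightarrow>
              D p v (\<lambda>q. tscale (f q) (s q)) =
                tscale (dir_deriv M p v f) (s p) + tscale (f p) (D p v s))) \<and>
        (\<forall>X. vector_field M W X \<longrightarrow> section_along M N u W (\<lambda>p. D p (X p) s)))"

abbreviation connection :: "('m, 'a::euclidean_space) manifold \<Rightarrow> ('m, 'a) conn \<Rightarrow> bool" where
  "connection M \<equiv> connection_along M M id"

text \<open>The connection induced on \<open>u\<^sup>-\<^sup>1TN\<close> by a connection \<open>D\<close> of \<open>N\<close>: the unique one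
  that satisfies the chain rule on sections of the form \<open>Y \<circ> u\<close>.\<close>

definition induced_connection ::
  "('m, 'a::euclidean_space) manifold \<Rightarrow> ('n, 'b::euclidean_space) manifold \<Rightarrow> ('m \<Rightarrow> 'n)
     \<Rightarrow> ('n, 'b) conn \<Rightarrow> ('m, 'a, 'n, 'b) conn_along \<Rightarrow> bool" where
  "induced_connection M N u D E \<longleftrightarrow> connection_along M N u E \<and>
     (\<forall>V Y. openin (mtop N) V \<longrightarrow> vector_field N V Y \<longrightarrow>
        (\<forall>p\<in>points M. u p \<in> V \<longrightarrow> (\<forall>v\<in>tangent_space M p.
           E p v (\<lambda>q. Y (u q)) = D (u p) (differential M N u p v) Y)))"

definition levi_civita_connection ::
  "('m, 'a::euclidean_space) manifold \<Rightarrow> ('m, 'a) form_field \<Rightarrow> ('m, 'a) conn \<Rightarrow> bool" where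
  "levi_civita_connection M g D \<longleftrightarrow> connection M D \<and>
     (\<forall>W X Y. openin (mtop M) W \<longrightarrow> vector_field M W X \<longrightarrow> vector_field M W Y \<longrightarrow>
        (\<forall>p\<in>W. D p (X p) Y - D p (Y p) X = lie_bracket M X Y p \<and>
           (\<forall>v\<in>tangent_space M p.
              dir_deriv M p v (\<lambda>q. g q (X q) (Y q)) = g p (D p v X) (Y p) + g p (X p) (D p v Y))))"

text \<open>\<open>deriv_endo D J p v Y\<close> is \<open>(\<nabla>\<^sub>vJ)Y\<close>.\<close>

definition deriv_endo ::
  "('m, 'a::euclidean_space) conn \<Rightarrow> ('m, 'a) endo_field
     \<Rightarrow> 'm \<Rightarrow> ('m, 'a) tvec \<Rightarrow> ('m \<Rightarrow> ('m, 'a) tvec) \<Rightarrow> ('m, 'a) tvec" where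
  "deriv_endo D J p v Y = D p v (\<lambda>q. J q (Y q)) - J p (D p v Y)"

definition second_canonical_connection ::
  "('m, 'a::euclidean_space) manifold \<Rightarrow> ('m, 'a) endo_field \<Rightarrow> ('m, 'a) form_field
     \<Rightarrow> ('m, 'a) conn \<Rightarrow> bool" where
  "second_canonical_connection M J g D' \<longleftrightarrow> connection M D' \<and>
     (\<exists>D. levi_civita_connection M g D \<and>
       (\<forall>W X Y Z. openin (mtop M) W \<longrightarrow>
          vector_field M W X \<longrightarrow> vector_field M W Y \<longrightarrow> vector_field M W Z \<longrightarrow>
          (\<forall>p\<in>W.
             g p (D' p (X p) Y) (Z p) =
               g p (D p (X p) Y) (Z p)
               - 1/2 * g p (J p (deriv_endo D J p (X p) Y)) (Z p)
               + 1/4 * (g p (X p) (deriv_endo D J p (J p (Y p)) Z + J p (deriv_endo D J p (Y p) Z))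
                      - g p (X p) (deriv_endo D J p (J p (Z p)) Y + J p (deriv_endo D J p (Z p) Y))))))"

section \<open>Hermitian pluriharmonic maps\<close>

text \<open>The second fundamental form \<open>(\<nabla>du)(X,Y)\<close> at \<open>p\<close>, where \<open>D\<close> is a connection of the source
  and \<open>E\<close> one of \<open>u\<^sup>-\<^sup>1TN\<close>.\<close>

definition second_form ::
  "('m, 'a::euclidean_space) manifold \<Rightarrow> ('n, 'b::euclidean_space) manifold \<Rightarrow> ('m \<Rightarrow> 'n)
     \<Rightarrow> ('m, 'a) conn \<Rightarrow> ('m, 'a, 'n, 'b) conn_along
     \<Rightarrow> ('m \<Rightarrow> ('m, 'a) tvec) \<Rightarrow> ('m \<Rightarrow> ('m, 'a) tvec) \<Rightarrow> 'm \<Rightarrow> ('n, 'b) tvec" where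
  "second_form M N u D E X Y p =
     E p (X p) (\<lambda>q. differential M N u q (Y q)) - differential M N u p (D p (X p) Y)"

text \<open>A section \<open>A + \<surd>-1 B\<close> of \<open>TM \<otimes> \<complex>\<close> is represented by the pair \<open>(A, B)\<close>, and likewise for
  complexified tangent vectors.\<close>

type_synonym ('m, 'a) cfield = "('m \<Rightarrow> ('m, 'a) tvec) \<times> ('m \<Rightarrow> ('m, 'a) tvec)"

definition complex_bilinear_extension ::
  "(('m \<Rightarrow> ('m, 'a) tvec) \<Rightarrow> ('m \<Rightarrow> ('m, 'a) tvec) \<Rightarrow> 'm \<Rightarrow> ('n, 'b::euclidean_space) tvec)
     \<Rightarrow> ('m, 'a) cfield \<Rightarrow> ('m, 'a) cfield \<Rightarrow> 'm \<Rightarrow> ('n, 'b) tvec \<times> ('n, 'b) tvec" where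
  "complex_bilinear_extension B Z W p =
     (B (fst Z) (fst W) p - B (snd Z) (snd W) p, B (fst Z) (snd W) p + B (snd Z) (fst W) p)"

definition cconj :: "('m, 'a::euclidean_space) cfield \<Rightarrow> ('m, 'a) cfield" where
  "cconj Z = (fst Z, \<lambda>p. - snd Z p)"

definition T10_fields ::
  "('m, 'a::euclidean_space) manifold \<Rightarrow> ('m, 'a) endo_field \<Rightarrow> 'm set \<Rightarrow> ('m, 'a) cfield set" where
  "T10_fields M J U = {(X, \<lambda>p. - J p (X p)) | X. vector_field M U X}"

text \<open>The second canonical connections and the induced connection exist and are unique (up to their
  junk values on non-sections), so the universal quantification over \<open>D\<close>, \<open>D'\<close>, \<open>E\<close> just names
  them. Local sections over all open \<open>U\<close> are allowed, including \<open>U = points M\<close>.\<close>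

definition hermitian_pluriharmonic ::
  "('m, 'a::euclidean_space) manifold \<Rightarrow> ('m, 'a) endo_field \<Rightarrow> ('m, 'a) form_field \<Rightarrow>
   ('n, 'b::euclidean_space) manifold \<Rightarrow> ('n, 'b) endo_field \<Rightarrow> ('n, 'b) form_field \<Rightarrow>
   ('m \<Rightarrow> 'n) \<Rightarrow> bool" where
  "hermitian_pluriharmonic M J g N J' h u \<longleftrightarrow>
     (\<forall>D D' E. second_canonical_connection M J g D \<longrightarrow> second_canonical_connection N J' h D' \<longrightarrow>
        induced_connection M N u D' E \<longrightarrow>
        (\<forall>U. openin (mtop M) U \<longrightarrow> (\<forall>Z\<in>T10_fields M J U. \<forall>W\<in>T10_fields M J U. \<forall>p\<in>U.
           complex_bilinear_extension (second_form M N u D E) Z (cconj W) p = (0, 0))))"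

end

(*
  The second canonical connection is J-parallel, and the J-invariant part T(X,Y) + T(JX,JY) of its
  torsion vanishes. Let B be the second fundamental form of the holomorphic map u. Since both
  connections are J-parallel, B(X,JY) = J' B(X,Y). The skew part of B is the difference of the torsions,
  T'(du X, du Y) - du T(X,Y), so C(X,Y) = B(X,Y) + B(JX,JY) is symmetric. Moreover
  C(X,JY) = J' C(X,Y) and C(JX,JY) = C(X,Y), hence
  C(X,Y) = C(JX,JY) = J' C(JX,Y) = J' C(Y,JX) = J' J' C(Y,X) = - C(X,Y).
  Both components of B(Z, conj W) for Z, W of type (1,0) are values of C.
*)
theory Submission
  imports Defs
begin

section \<open>Calculus\<close>

text \<open>The torsions in the overview are tensors, but a connection acts on sections, and
  \<open>du X\<close> is a section along \<open>u\<close> that in general extends to no vector field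
  on \<open>N\<close>. The induced connection is known only through its chain rule on sections of
  the form \<open>Y o u\<close>. Hence everything along \<open>u\<close> is expanded in the
  pulled-back coordinate fields of one chart of \<open>N\<close>: derivatives of coefficients are
  ordinary calculus, derivatives of the frame come from the connection of \<open>N\<close>. In the
  skew part of \<open>B\<close> the second derivatives of the coordinate form of \<open>u\<close>
  cancel by symmetry and leave \<open>du [X,Y]\<close>; the frame terms form the torsion of
  \<open>N\<close>, written in the frame. The same formula for \<open>u = id\<close> identifies that
  expression with the genuine torsion. The two properties of the second canonical connection are
  derived from its defining formula. The constant 1/2 there is what makes \<open>J\<close> parallel,
  and 1/4 is what makes the \<open>J\<close>-invariant part of the torsion vanish.\<close>

lemma frechet_derivative_eqI: "(f has_derivative f') (at x) \<Longrightarrow> frechet_derivative f (at x) = f'"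
  using frechet_derivative_at by metis

text \<open>\<open>Ck_on\<close> controls derivatives in fixed directions only. Expanding in the
  basis reduces a direction that varies with the point to finitely many fixed ones.\<close>

lemma frechet_derivative_linear_sum:
  fixes f :: "'a::euclidean_space \<Rightarrow> 'b::real_normed_vector"
  assumes "f differentiable (at x)"
  shows "frechet_derivative f (at x) v = (\<Sum>b\<in>Basis. (v \<bullet> b) *\<^sub>R frechet_derivative f (at x) b)"
proof -
  have l: "linear (frechet_derivative f (at x))"
    using assms by (rule linear_frechet_derivative)
  have "frechet_derivative f (at x) v = frechet_derivative f (at x) (\<Sum>b\<in>Basis. (v \<bullet> b) *\<^sub>R b)"
    by (simp add: euclidean_representation)
  then show ?thesis by (simp add: linear_sum[OF l] linear_scale[OF l])
qed

lemma differentiable_cong_open: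
  assumes "open S" "x \<in> S" "\<And>y. y \<in> S \<Longrightarrow> f y = g y" "f differentiable (at x)"
  shows "g differentiable (at x)"
  using assms unfolding differentiable_def
  by (meson has_derivative_transform_within_open)

text \<open>\<open>frechet_derivative\<close> is a choice among all derivatives; equality near
  \<open>x\<close> makes the two choice predicates coincide, so the chosen values agree.\<close>

lemma frechet_derivative_cong_open:
  assumes "open S" "x \<in> S" "\<And>y. y \<in> S \<Longrightarrow> f y = g y"
  shows "frechet_derivative f (at x) = frechet_derivative g (at x)"
proof -
  have "(f has_derivative f') (at x) = (g has_derivative f') (at x)" for f'
    using has_derivative_transform_within_open[of f f' x UNIV S g]
      has_derivative_transform_within_open[of g f' x UNIV S f] assms by auto
  then show ?thesis unfolding frechet_derivative_def by simp
qed

section \<open>Closure properties of C^k maps on open sets\<close>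

lemma Ck_on_Suc_has_derivative:
  "Ck_on (Suc k) S f \<Longrightarrow> x \<in> S \<Longrightarrow> (f has_derivative frechet_derivative f (at x)) (at x)"
  by (simp flip: frechet_derivative_works)

text \<open>\<open>Ck_on\<close> refers to \<open>frechet_derivative\<close> itself, whereas the
  rules below know it as a formula valid on \<open>S\<close>. Since \<open>S\<close> is open, one
  may replace the other at every order.\<close>

lemma Ck_on_cong:
  assumes "open S" "\<And>x. x \<in> S \<Longrightarrow> f x = g x" "Ck_on k S f"
  shows "Ck_on k S g"
  using assms
proof (induction k arbitrary: f g)
  case 0
  then show ?case using continuous_on_eq by fastforce
next
  case (Suc k)
  have "g differentiable (at x)" if "x \<in> S" for x
    using differentiable_cong_open[OF Suc.prems(1) that Suc.prems(2)] Suc.prems(3) that by auto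
  moreover have "Ck_on k S (\<lambda>x. frechet_derivative g (at x) v)" for v
    by (rule Suc.IH[OF Suc.prems(1), of "\<lambda>x. frechet_derivative f (at x) v"])
       (use frechet_derivative_cong_open[OF Suc.prems(1) _ Suc.prems(2)] Suc.prems(3) in auto)
  ultimately show ?case by simp
qed

lemma Ck_on_subset: "Ck_on k T f \<Longrightarrow> S \<subseteq> T \<Longrightarrow> Ck_on k S f"
  by (induction k arbitrary: f) (auto intro: continuous_on_subset)

lemma Ck_on_Suc_imp_continuous: "Ck_on (Suc k) S f \<Longrightarrow> continuous_on S f"
  by (auto intro!: continuous_at_imp_continuous_on differentiable_imp_continuous_within)

lemma Ck_on_Suc_imp: "Ck_on (Suc k) S f \<Longrightarrow> Ck_on k S f"
proof (induction k arbitrary: f)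
  case 0
  then show ?case using Ck_on_Suc_imp_continuous[of 0] by simp
next
  case (Suc k)
  then show ?case by (metis Ck_on.simps(2))
qed

lemma Ck_on_const: "Ck_on k S (\<lambda>x. c)"
  by (induction k arbitrary: c) (auto simp: frechet_derivative_const)

lemma Ck_on_linear:
  assumes "open S" "bounded_linear L" "Ck_on k S f"
  shows "Ck_on k S (\<lambda>x. L (f x))"
  using assms(3)
proof (induction k arbitrary: f)
  case 0
  then show ?case by (simp add: bounded_linear.continuous_on[OF assms(2)])
next
  case (Suc k)
  have d: "((\<lambda>x. L (f x)) has_derivative (\<lambda>v. L (frechet_derivative f (at x) v))) (at x)"
    if "x \<in> S" for x
    by (rule bounded_linear.has_derivative[OF assms(2)])
       (use Suc.prems that frechet_derivative_works in auto)
  have "Ck_on k S (\<lambda>x. frechet_derivative (\<lambda>x. L (f x)) (at x) v)" for v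
    by (rule Ck_on_cong[OF assms(1), of "\<lambda>x. L (frechet_derivative f (at x) v)"])
       (use Suc frechet_derivative_eqI[OF d] in auto)
  then show ?case using d by (auto simp: differentiable_def)
qed

lemma Ck_on_add:
  assumes "open S" "Ck_on k S f" "Ck_on k S g"
  shows "Ck_on k S (\<lambda>x. f x + g x)"
  using assms(2,3)
proof (induction k arbitrary: f g)
  case 0
  then show ?case by (simp add: continuous_on_add)
next
  case (Suc k)
  have d: "((\<lambda>x. f x + g x) has_derivative
      (\<lambda>v. frechet_derivative f (at x) v + frechet_derivative g (at x) v)) (at x)"
    if "x \<in> S" for x
    using Suc.prems that by (intro has_derivative_add Ck_on_Suc_has_derivative)
  have "Ck_on k S (\<lambda>x. frechet_derivative (\<lambda>x. f x + g x) (at x) v)" for v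
    by (rule Ck_on_cong[OF assms(1),
          of "\<lambda>x. frechet_derivative f (at x) v + frechet_derivative g (at x) v"])
       (use Suc frechet_derivative_eqI[OF d] in auto)
  then show ?case using d by (auto simp: differentiable_def)
qed

lemma Ck_on_scaleR:
  assumes "open S" "Ck_on k S f" "Ck_on k S g"
  shows "Ck_on k S (\<lambda>x. f x *\<^sub>R g x)"
  using assms(2,3)
proof (induction k arbitrary: f g)
  case 0
  then show ?case by (simp add: continuous_on_scaleR)
next
  case (Suc k)
  have d: "((\<lambda>x. f x *\<^sub>R g x) has_derivative
      (\<lambda>v. f x *\<^sub>R frechet_derivative g (at x) v + frechet_derivative f (at x) v *\<^sub>R g x)) (at x)"
    if "x \<in> S" for x
    using Suc.prems that by (intro has_derivative_scaleR Ck_on_Suc_has_derivative)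
  have "Ck_on k S (\<lambda>x. frechet_derivative (\<lambda>x. f x *\<^sub>R g x) (at x) v)" for v
  proof (rule Ck_on_cong[OF assms(1),
          of "\<lambda>x. f x *\<^sub>R frechet_derivative g (at x) v + frechet_derivative f (at x) v *\<^sub>R g x"])
    \<comment> \<open>The product rule keeps each factor once undifferentiated, so the factors
      themselves are needed at order \<open>k\<close> too; \<open>Ck_on_Suc_imp\<close> provides
      this.\<close>
    show "Ck_on k S (\<lambda>x. f x *\<^sub>R frechet_derivative g (at x) v + frechet_derivative f (at x) v *\<^sub>R g x)"
      by (intro Ck_on_add assms(1) Suc.IH) (use Suc.prems Ck_on_Suc_imp in auto)
  qed (use frechet_derivative_eqI[OF d] in auto)
  then show ?case using d by (auto simp: differentiable_def)
qed

lemma Ck_on_sum: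
  assumes "open S" "finite I" "\<And>i. i \<in> I \<Longrightarrow> Ck_on k S (f i)"
  shows "Ck_on k S (\<lambda>x. \<Sum>i\<in>I. f i x)"
  using assms(2,3) by (induction I) (auto intro: Ck_on_const Ck_on_add[OF assms(1)])

text \<open>Induction on the order with the outer map \<open>f\<close> arbitrary and
  \<open>g\<close> fixed: by the chain rule a derivative is a sum of products of components of the
  derivative of \<open>g\<close> with functions that are again compositions with
  \<open>g\<close>.\<close>

lemma Ck_on_compose:
  assumes "open S" "open T" "g ` S \<subseteq> T" "Ck_on k S g" "Ck_on k T f"
  shows "Ck_on k S (\<lambda>x. f (g x))"
  using assms(4,5)
proof (induction k arbitrary: f)
  case 0
  then show ?case using assms(3) by (auto intro: continuous_on_compose2)
next
  case (Suc k)
  have fd: "f differentiable (at (g x))" if "x \<in> S" for x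
    using Suc.prems(2) that assms(3) by auto
  have d: "((\<lambda>x. f (g x)) has_derivative
      (\<lambda>v. frechet_derivative f (at (g x)) (frechet_derivative g (at x) v))) (at x)"
    if "x \<in> S" for x
    by (rule has_derivative_compose)
       (use Suc.prems that fd frechet_derivative_works in auto)
  have "Ck_on k S (\<lambda>x. frechet_derivative (\<lambda>x. f (g x)) (at x) v)" for v
  proof (rule Ck_on_cong[OF assms(1), of
        "\<lambda>x. \<Sum>b\<in>Basis. (frechet_derivative g (at x) v \<bullet> b) *\<^sub>R frechet_derivative f (at (g x)) b"])
    show "Ck_on k S (\<lambda>x. \<Sum>b\<in>Basis. (frechet_derivative g (at x) v \<bullet> b) *\<^sub>R
        frechet_derivative f (at (g x)) b)"
    proof (intro Ck_on_sum Ck_on_scaleR assms(1))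
      fix b :: 'b
      show "Ck_on k S (\<lambda>x. frechet_derivative g (at x) v \<bullet> b)"
        by (rule Ck_on_linear[OF assms(1) bounded_linear_inner_left]) (use Suc.prems in auto)
      show "Ck_on k S (\<lambda>x. frechet_derivative f (at (g x)) b)"
        by (rule Suc.IH) (use Suc.prems Ck_on_Suc_imp in auto)
    qed auto
    show "(\<Sum>b\<in>Basis. (frechet_derivative g (at x) v \<bullet> b) *\<^sub>R frechet_derivative f (at (g x)) b) =
        frechet_derivative (\<lambda>x. f (g x)) (at x) v" if "x \<in> S" for x
      using frechet_derivative_linear_sum[OF fd[OF that]] frechet_derivative_eqI[OF d[OF that]]
      by metis
  qed
  then show ?case using d by (auto simp: differentiable_def)
qed

section \<open>The same rules for smooth maps\<close>

lemma smooth_on_cong: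
  "open S \<Longrightarrow> smooth_on S f \<Longrightarrow> (\<And>x. x \<in> S \<Longrightarrow> f x = g x) \<Longrightarrow> smooth_on S g"
  unfolding smooth_on_def by (meson Ck_on_cong)

lemma smooth_on_subset: "smooth_on T f \<Longrightarrow> S \<subseteq> T \<Longrightarrow> smooth_on S f"
  unfolding smooth_on_def by (meson Ck_on_subset)

lemma smooth_on_const: "smooth_on S (\<lambda>x. c)"
  by (simp add: smooth_on_def Ck_on_const)

lemma smooth_on_linear:
  "open S \<Longrightarrow> bounded_linear L \<Longrightarrow> smooth_on S f \<Longrightarrow> smooth_on S (\<lambda>x. L (f x))"
  by (simp add: smooth_on_def Ck_on_linear)

lemma smooth_on_inner: "open S \<Longrightarrow> smooth_on S f \<Longrightarrow> smooth_on S (\<lambda>x. f x \<bullet> b)"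
  by (rule smooth_on_linear[OF _ bounded_linear_inner_left])

lemma smooth_on_add:
  "open S \<Longrightarrow> smooth_on S f \<Longrightarrow> smooth_on S g \<Longrightarrow> smooth_on S (\<lambda>x. f x + g x)"
  by (simp add: smooth_on_def Ck_on_add)

lemma smooth_on_scaleR:
  "open S \<Longrightarrow> smooth_on S f \<Longrightarrow> smooth_on S g \<Longrightarrow> smooth_on S (\<lambda>x. f x *\<^sub>R g x)"
  by (simp add: smooth_on_def Ck_on_scaleR)

lemma smooth_on_sum:
  "open S \<Longrightarrow> finite I \<Longrightarrow> (\<And>i. i \<in> I \<Longrightarrow> smooth_on S (f i)) \<Longrightarrow> smooth_on S (\<lambda>x. \<Sum>i\<in>I. f i x)"
  by (simp add: smooth_on_def Ck_on_sum)

lemma smooth_on_compose: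
  "open S \<Longrightarrow> open T \<Longrightarrow> g ` S \<subseteq> T \<Longrightarrow> smooth_on S g \<Longrightarrow> smooth_on T f \<Longrightarrow> smooth_on S (\<lambda>x. f (g x))"
  by (simp add: smooth_on_def Ck_on_compose)

lemma smooth_on_differentiable: "smooth_on S f \<Longrightarrow> x \<in> S \<Longrightarrow> f differentiable (at x)"
  unfolding smooth_on_def using Ck_on.simps(2)[of 0] by blast

lemma smooth_on_has_derivative:
  "smooth_on S f \<Longrightarrow> x \<in> S \<Longrightarrow> (f has_derivative frechet_derivative f (at x)) (at x)"
  using smooth_on_differentiable frechet_derivative_works by blast

lemma smooth_on_frechet_derivative:
  "smooth_on S f \<Longrightarrow> smooth_on S (\<lambda>x. frechet_derivative f (at x) v)"
  unfolding smooth_on_def using Ck_on.simps(2) by blast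

lemma smooth_on_frechet_derivative_apply:
  assumes "open S" "smooth_on S f" "smooth_on S h"
  shows "smooth_on S (\<lambda>x. frechet_derivative f (at x) (h x))"
proof (rule smooth_on_cong[OF assms(1)])
  show "smooth_on S (\<lambda>x. \<Sum>b\<in>Basis. (h x \<bullet> b) *\<^sub>R frechet_derivative f (at x) b)"
    by (intro smooth_on_sum smooth_on_scaleR smooth_on_inner smooth_on_frechet_derivative assms) auto
qed (use frechet_derivative_linear_sum smooth_on_differentiable[OF assms(2)] in metis)

text \<open>Symmetry of second derivatives: the second difference of \<open>f\<close> along the directions \<open>v\<close>, \<open>w\<close>
  is, by two applications of the mean value theorem, a value of either mixed derivative nearby.\<close>

lemma second_difference_mean_value:
  fixes f :: "'a::euclidean_space \<Rightarrow> real"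
  assumes "Ck_on 2 S f" "0 < h"
    and S: "\<And>s t. \<lbrakk>0 \<le> s; s \<le> h; 0 \<le> t; t \<le> h\<rbrakk> \<Longrightarrow> x + s *\<^sub>R v + t *\<^sub>R w \<in> S"
  shows "\<exists>s t. 0 < s \<and> s < h \<and> 0 < t \<and> t < h \<and>
    f (x + h *\<^sub>R v + h *\<^sub>R w) - f (x + h *\<^sub>R v) - f (x + h *\<^sub>R w) + f x =
    h * h * frechet_derivative (\<lambda>y. frechet_derivative f (at y) v) (at (x + s *\<^sub>R v + t *\<^sub>R w)) w"
proof -
  let ?D = "\<lambda>y. frechet_derivative f (at y) v"
  have df: "f differentiable (at y)" if "y \<in> S" for y
    using assms(1) that by (simp add: numeral_2_eq_2)
  have dD: "?D differentiable (at y)" if "y \<in> S" for y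
    using assms(1) that by (simp add: numeral_2_eq_2)
  have line: "((\<lambda>s. f (a + s *\<^sub>R v)) has_derivative (\<lambda>r. r * ?D (a + s *\<^sub>R v))) (at s)"
    if "a + s *\<^sub>R v \<in> S" for a s
  proof -
    have "((\<lambda>s. f (a + s *\<^sub>R v)) has_derivative
        (\<lambda>r. frechet_derivative f (at (a + s *\<^sub>R v)) (r *\<^sub>R v))) (at s)"
      by (rule has_derivative_compose[where f="\<lambda>s. a + s *\<^sub>R v"])
         (use df[OF that] frechet_derivative_works in \<open>auto intro!: derivative_eq_intros\<close>)
    then show ?thesis
      using linear_scale[OF linear_frechet_derivative[OF df[OF that]]] by simp
  qed
  have lineD: "((\<lambda>t. ?D (a + t *\<^sub>R w)) has_derivative
      (\<lambda>r. r * frechet_derivative ?D (at (a + t *\<^sub>R w)) w)) (at t)"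
    if "a + t *\<^sub>R w \<in> S" for a t
  proof -
    have "((\<lambda>t. ?D (a + t *\<^sub>R w)) has_derivative
        (\<lambda>r. frechet_derivative ?D (at (a + t *\<^sub>R w)) (r *\<^sub>R w))) (at t)"
      by (rule has_derivative_compose[where f="\<lambda>s. a + s *\<^sub>R w"])
         (use dD[OF that] frechet_derivative_works in \<open>auto intro!: derivative_eq_intros\<close>)
    then show ?thesis
      using linear_scale[OF linear_frechet_derivative[OF dD[OF that]]] by simp
  qed
  \<comment> \<open>With the increment in direction \<open>w\<close> frozen, the second difference
    becomes the increment of \<open>?p\<close> over \<open>[0, h]\<close>.\<close>
  let ?p = "\<lambda>s. f (x + h *\<^sub>R w + s *\<^sub>R v) - f (x + s *\<^sub>R v)"
  have S1: "x + h *\<^sub>R w + s *\<^sub>R v \<in> S" "x + s *\<^sub>R v \<in> S" if "0 \<le> s" "s \<le> h" for s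
    using S[of s h] S[of s 0] that assms(2) by (auto simp: algebra_simps)
  have dp: "(?p has_derivative (\<lambda>r. r * (?D (x + h *\<^sub>R w + s *\<^sub>R v) - ?D (x + s *\<^sub>R v)))) (at s)"
    if "0 \<le> s" "s \<le> h" for s
    using has_derivative_diff[OF line[OF S1(1)[OF that]] line[OF S1(2)[OF that]]]
    by (simp add: algebra_simps)
  have "\<exists>s\<in>{0<..<h}. ?p h - ?p 0 = (h - 0) * (?D (x + h *\<^sub>R w + s *\<^sub>R v) - ?D (x + s *\<^sub>R v))"
    by (rule mvt_simple[OF assms(2) has_derivative_at_withinI[OF dp]]) auto
  then obtain s where s: "0 < s" "s < h"
    and ps: "?p h - ?p 0 = h * (?D (x + h *\<^sub>R w + s *\<^sub>R v) - ?D (x + s *\<^sub>R v))"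
    by auto
  let ?q = "\<lambda>t. ?D ((x + s *\<^sub>R v) + t *\<^sub>R w)"
  have dq: "(?q has_derivative (\<lambda>r. r * frechet_derivative ?D (at ((x + s *\<^sub>R v) + t *\<^sub>R w)) w)) (at t)"
    if "0 \<le> t" "t \<le> h" for t
    by (rule lineD) (use S[of s t] s that in auto)
  have "\<exists>t\<in>{0<..<h}. ?q h - ?q 0 = (h - 0) * frechet_derivative ?D (at ((x + s *\<^sub>R v) + t *\<^sub>R w)) w"
    by (rule mvt_simple[OF assms(2) has_derivative_at_withinI[OF dq]]) auto
  then obtain t where t: "0 < t" "t < h"
    and qt: "?q h - ?q 0 = h * frechet_derivative ?D (at ((x + s *\<^sub>R v) + t *\<^sub>R w)) w"
    by auto
  have "f (x + h *\<^sub>R v + h *\<^sub>R w) - f (x + h *\<^sub>R v) - f (x + h *\<^sub>R w) + f x = ?p h - ?p 0"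
    by (simp add: add_ac)
  also have "\<dots> = h * (?q h - ?q 0)" using ps by (simp add: add_ac)
  finally show ?thesis using s t qt by auto
qed

lemma second_derivative_symmetric_real:
  fixes f :: "'a::euclidean_space \<Rightarrow> real"
  assumes "open S" "x \<in> S" "Ck_on 2 S f"
  shows "frechet_derivative (\<lambda>y. frechet_derivative f (at y) v) (at x) w =
         frechet_derivative (\<lambda>y. frechet_derivative f (at y) w) (at x) v" (is "?A x = ?B x")
proof (rule ccontr)
  assume ne: "?A x \<noteq> ?B x"
  \<comment> \<open>Half the gap: no number lies within \<open>e\<close> of both \<open>?A x\<close>
    and \<open>?B x\<close>.\<close>
  define e where "e = \<bar>?A x - ?B x\<bar> / 2"
  have e: "e > 0" using ne by (simp add: e_def)
  have "continuous_on S ?A" "continuous_on S ?B"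
    using assms(3) by (auto simp: numeral_2_eq_2)
  then have "isCont ?A x" "isCont ?B x"
    using assms(1,2) continuous_on_eq_continuous_at by blast+
  then have "\<forall>\<^sub>F y in at x. dist (?A y) (?A x) < e" "\<forall>\<^sub>F y in at x. dist (?B y) (?B x) < e"
    using e by (auto simp: isCont_def tendsto_iff)
  then have "\<forall>\<^sub>F y in at x. dist (?A y) (?A x) < e \<and> dist (?B y) (?B x) < e \<and> y \<in> S"
    using assms(1,2) by (simp add: eventually_conj eventually_at_in_open')
  then obtain d where d: "d > 0"
    and dd: "\<And>y. y \<noteq> x \<Longrightarrow> dist y x < d \<Longrightarrow>
      dist (?A y) (?A x) < e \<and> dist (?B y) (?B x) < e \<and> y \<in> S"
    by (auto simp: eventually_at)
  \<comment> \<open>Small enough that the whole parallelogram at \<open>x\<close> with sides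
    \<open>h v\<close> and \<open>h w\<close> stays within distance \<open>d\<close>; the summand 1
    keeps the denominator positive when \<open>v\<close> and \<open>w\<close> vanish.\<close>
  define h where "h = d / (2 * (norm v + norm w + 1))"
  have pos: "norm v + norm w + 1 > 0" by (smt (verit) norm_ge_zero)
  have h: "h > 0" using d pos by (simp add: h_def)
  have hb: "h * (norm v + norm w) < d"
  proof -
    have "h * (norm v + norm w) \<le> h * (norm v + norm w + 1)" using h by (simp add: mult_left_mono)
    also have "\<dots> = d / 2" using pos by (simp add: h_def field_simps)
    finally show ?thesis using d by simp
  qed
  have near: "dist (?A y) (?A x) < e \<and> dist (?B y) (?B x) < e \<and> y \<in> S"
    if "y = x + s *\<^sub>R v + t *\<^sub>R w" "0 \<le> s" "s \<le> h" "0 \<le> t" "t \<le> h" for y s t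
  proof (cases "y = x")
    case True
    then show ?thesis using e assms(2) by simp
  next
    case False
    have "dist y x = norm (s *\<^sub>R v + t *\<^sub>R w)" using that(1) by (simp add: dist_norm)
    also have "\<dots> \<le> s * norm v + t * norm w"
      using norm_triangle_ineq[of "s *\<^sub>R v" "t *\<^sub>R w"] that by simp
    also have "\<dots> \<le> h * norm v + h * norm w"
      using that by (intro add_mono mult_right_mono) auto
    also have "\<dots> < d" using hb by (simp add: algebra_simps)
    finally show ?thesis using dd False by blast
  qed
  obtain s t where st: "0 < s" "s < h" "0 < t" "t < h"
    and A: "f (x + h *\<^sub>R v + h *\<^sub>R w) - f (x + h *\<^sub>R v) - f (x + h *\<^sub>R w) + f x =
      h * h * ?A (x + s *\<^sub>R v + t *\<^sub>R w)"
    using second_difference_mean_value[OF assms(3) h, of x v w] near by blast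
  have "x + t' *\<^sub>R w + s' *\<^sub>R v \<in> S" if "0 \<le> t'" "t' \<le> h" "0 \<le> s'" "s' \<le> h" for s' t'
    using near[OF refl, of s' t'] that by (simp add: add_ac)
  \<comment> \<open>With \<open>v\<close> and \<open>w\<close> exchanged, the same second difference
    is a value of the other mixed derivative.\<close>
  then obtain t' s' where st': "0 < t'" "t' < h" "0 < s'" "s' < h"
    and B: "f (x + h *\<^sub>R w + h *\<^sub>R v) - f (x + h *\<^sub>R w) - f (x + h *\<^sub>R v) + f x =
      h * h * ?B (x + t' *\<^sub>R w + s' *\<^sub>R v)"
    using second_difference_mean_value[OF assms(3) h, of x w v] by blast
  have "h * h * ?A (x + s *\<^sub>R v + t *\<^sub>R w) = h * h * ?B (x + t' *\<^sub>R w + s' *\<^sub>R v)"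
  proof -
    have swap: "x + h *\<^sub>R w + h *\<^sub>R v = x + h *\<^sub>R v + h *\<^sub>R w" by simp
    show ?thesis using A B unfolding swap by linarith
  qed
  then have "?A (x + s *\<^sub>R v + t *\<^sub>R w) = ?B (x + t' *\<^sub>R w + s' *\<^sub>R v)"
    using h by simp
  then have "?A (x + s *\<^sub>R v + t *\<^sub>R w) = ?B (x + s' *\<^sub>R v + t' *\<^sub>R w)"
    by (simp add: add_ac)
  moreover have "dist (?A (x + s *\<^sub>R v + t *\<^sub>R w)) (?A x) < e"
    using near[OF refl, of s t] st by simp
  moreover have "dist (?B (x + s' *\<^sub>R v + t' *\<^sub>R w)) (?B x) < e"
    using near[OF refl, of s' t'] st' by simp
  ultimately show False unfolding dist_real_def e_def
    by (smt (verit) field_sum_of_halves)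
qed

text \<open>The mean value argument is for real functions; taking a component commutes with both
  derivatives, so the basis components can be treated one by one.\<close>

lemma second_derivative_symmetric:
  fixes f :: "'a::euclidean_space \<Rightarrow> 'b::euclidean_space"
  assumes "open S" "x \<in> S" "smooth_on S f"
  shows "frechet_derivative (\<lambda>y. frechet_derivative f (at y) v) (at x) w =
         frechet_derivative (\<lambda>y. frechet_derivative f (at y) w) (at x) v"
proof (rule euclidean_eqI)
  fix b :: 'b assume "b \<in> Basis"
  have inner: "frechet_derivative (\<lambda>y. k y \<bullet> b) (at y) z = frechet_derivative k (at y) z \<bullet> b"
    if "smooth_on S k" "y \<in> S" for k :: "'a \<Rightarrow> 'b" and y z
    by (subst frechet_derivative_eqI[OF bounded_linear.has_derivative[OF bounded_linear_inner_left
            smooth_on_has_derivative[OF that]]]) simp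
  have "frechet_derivative (\<lambda>y. frechet_derivative f (at y) v) (at x) w \<bullet> b =
      frechet_derivative (\<lambda>y. frechet_derivative (\<lambda>y. f y \<bullet> b) (at y) v) (at x) w" for v w
    by (subst inner[symmetric, OF smooth_on_frechet_derivative[OF assms(3)] assms(2)])
       (rule arg_cong[where f="\<lambda>F. F w"], rule frechet_derivative_cong_open[OF assms(1,2)],
         simp add: inner assms(3))
  moreover have "Ck_on 2 S (\<lambda>y. f y \<bullet> b)"
    using smooth_on_inner[OF assms(1,3)] smooth_on_def by blast
  ultimately show "frechet_derivative (\<lambda>y. frechet_derivative f (at y) v) (at x) w \<bullet> b =
      frechet_derivative (\<lambda>y. frechet_derivative f (at y) w) (at x) v \<bullet> b"
    using second_derivative_symmetric_real[OF assms(1,2), of "\<lambda>y. f y \<bullet> b" v w] by simp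
qed

text \<open>In the difference for two vector fields the second derivatives of \<open>f\<close> cancel.\<close>

lemma frechet_derivative_bracket:
  fixes f :: "'a::euclidean_space \<Rightarrow> 'b::euclidean_space"
  assumes "open S" "x \<in> S" "smooth_on S f" "smooth_on S X" "smooth_on S Y"
  shows "frechet_derivative (\<lambda>y. frechet_derivative f (at y) (Y y)) (at x) (X x)
       - frechet_derivative (\<lambda>y. frechet_derivative f (at y) (X y)) (at x) (Y x)
       = frechet_derivative f (at x)
           (frechet_derivative Y (at x) (X x) - frechet_derivative X (at x) (Y x))"
proof -
  let ?D = "\<lambda>b y. frechet_derivative f (at y) b"
  let ?H = "\<lambda>v w. frechet_derivative (\<lambda>y. frechet_derivative f (at y) v) (at x) w"
  have lin: "linear (frechet_derivative f (at x))"
    using linear_frechet_derivative smooth_on_differentiable assms by blast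
  \<comment> \<open>Linearity of \<open>?H\<close> is immediate only in the direction
    \<open>w\<close>; symmetry carries it over to \<open>v\<close>.\<close>
  have H: "?H v w = (\<Sum>b\<in>Basis. (v \<bullet> b) *\<^sub>R ?H b w)" for v w
  proof -
    have sym: "?H v w = ?H w v" for v w by (rule second_derivative_symmetric[OF assms(1-3)])
    have "?H v w = ?H w v" by (rule sym)
    also have "\<dots> = (\<Sum>b\<in>Basis. (v \<bullet> b) *\<^sub>R ?H w b)"
      by (rule frechet_derivative_linear_sum)
         (rule smooth_on_differentiable[OF smooth_on_frechet_derivative[OF assms(3)] assms(2)])
    also have "\<dots> = (\<Sum>b\<in>Basis. (v \<bullet> b) *\<^sub>R ?H b w)"
      by (intro sum.cong refl arg_cong2[where f=scaleR] sym)
    finally show ?thesis .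
  qed
  \<comment> \<open>Product rule. The first summand is the second derivative of \<open>f\<close>,
    which drops out of the final difference by symmetry; only derivatives of the fields
    survive.\<close>
  have key: "frechet_derivative (\<lambda>y. frechet_derivative f (at y) (Y y)) (at x) w =
      ?H (Y x) w + frechet_derivative f (at x) (frechet_derivative Y (at x) w)"
    if Y: "smooth_on S Y" for Y w
  proof -
    have "frechet_derivative (\<lambda>y. frechet_derivative f (at y) (Y y)) (at x) =
        frechet_derivative (\<lambda>y. \<Sum>b\<in>Basis. (Y y \<bullet> b) *\<^sub>R ?D b y) (at x)"
      by (rule frechet_derivative_cong_open[OF assms(1,2)])
         (use frechet_derivative_linear_sum smooth_on_differentiable[OF assms(3)] in blast)
    also have "\<dots> = (\<lambda>w. \<Sum>b\<in>Basis. (Y x \<bullet> b) *\<^sub>R ?H b w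
        + (frechet_derivative Y (at x) w \<bullet> b) *\<^sub>R ?D b x)"
      by (rule frechet_derivative_eqI)
         (intro has_derivative_sum has_derivative_scaleR
            bounded_linear.has_derivative[OF bounded_linear_inner_left]
            smooth_on_has_derivative[OF _ assms(2)] smooth_on_frechet_derivative assms(3) Y)
    finally show ?thesis
      using H[of "Y x" w] frechet_derivative_linear_sum[OF smooth_on_differentiable[OF assms(3,2)],
          of "frechet_derivative Y (at x) w"]
      by (simp add: sum.distrib)
  qed
  show ?thesis
    unfolding key[OF assms(4)] key[OF assms(5)] linear_diff[OF lin]
      second_derivative_symmetric[OF assms(1-3), of "X x" "Y x"] by simp
qed

section \<open>Manifolds\<close>

text \<open>For \<open>u = id\<close> this is the transition map, so coordinate changes and general
  maps share one chain rule, \<open>jac_compose\<close>.\<close>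

definition local_rep :: "('m, 'a) chart \<Rightarrow> ('n, 'b) chart \<Rightarrow> ('m \<Rightarrow> 'n) \<Rightarrow> 'a \<Rightarrow> 'b" where
  "local_rep c d u = (\<lambda>x. snd d (u (chart_inv c x)))"

definition jac ::
  "('m, 'a::euclidean_space) chart \<Rightarrow> ('n, 'b::euclidean_space) chart \<Rightarrow> ('m \<Rightarrow> 'n) \<Rightarrow> 'm \<Rightarrow> 'a \<Rightarrow> 'b" where
  "jac c d u p = frechet_derivative (local_rep c d u) (at (snd c p))"

lemma chart_subset: "smooth_manifold M \<Longrightarrow> c \<in> atlas M \<Longrightarrow> fst c \<subseteq> points M"
  unfolding smooth_manifold_def by blast

lemma chart_openin: "smooth_manifold M \<Longrightarrow> c \<in> atlas M \<Longrightarrow> openin (mtop M) (fst c)"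
  unfolding smooth_manifold_def by blast

lemma chart_inv_chart:
  assumes "smooth_manifold M" "c \<in> atlas M" "p \<in> fst c"
  shows "chart_inv c (snd c p) = p"
proof -
  have "homeomorphic_map (subtopology (mtop M) (fst c)) (top_of_set (snd c ` fst c)) (snd c)"
    using assms(1,2) unfolding smooth_manifold_def by blast
  then have "inj_on (snd c) (topspace (subtopology (mtop M) (fst c)))"
    by (simp add: homeomorphic_eq_everything_map)
  moreover have "topspace (subtopology (mtop M) (fst c)) = fst c"
    using chart_subset[OF assms(1,2)] by auto
  ultimately show ?thesis using assms(3) by (simp add: chart_inv_def inv_into_f_f)
qed

lemma open_chart_image:
  assumes "smooth_manifold M" "c \<in> atlas M" "openin (mtop M) W" "W \<subseteq> fst c"
  shows "open (snd c ` W)"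
proof -
  have h: "homeomorphic_map (subtopology (mtop M) (fst c)) (top_of_set (snd c ` fst c)) (snd c)"
    and o: "open (snd c ` fst c)"
    using assms(1,2) unfolding smooth_manifold_def by blast+
  have "openin (subtopology (mtop M) (fst c)) W"
    unfolding openin_subtopology using assms(3,4) by (intro exI[of _ W]) auto
  moreover have "open_map (subtopology (mtop M) (fst c)) (top_of_set (snd c ` fst c)) (snd c)"
    by (rule homeomorphic_imp_open_map[OF h])
  ultimately have "openin (top_of_set (snd c ` fst c)) (snd c ` W)"
    by (simp add: open_map_def)
  then show ?thesis by (rule openin_open_trans[OF _ o])
qed

lemma charts_atD: "c \<in> charts_at M p \<Longrightarrow> c \<in> atlas M" "c \<in> charts_at M p \<Longrightarrow> p \<in> fst c"
  by (auto simp: charts_at_def)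

lemma charts_at_point: "smooth_manifold M \<Longrightarrow> c \<in> charts_at M p \<Longrightarrow> p \<in> points M"
  using chart_subset[of M c] by (auto simp: charts_at_def)

lemma chart_at_in:
  assumes "smooth_manifold M" "p \<in> points M"
  shows "chart_at M p \<in> charts_at M p"
proof -
  have "p \<in> (\<Union>c\<in>atlas M. fst c)" using assms by (simp add: smooth_manifold_def)
  then have "\<exists>c. c \<in> charts_at M p" by (auto simp: charts_at_def)
  then show ?thesis unfolding chart_at_def by (rule someI_ex)
qed

lemma smooth_map_point: "smooth_map M N u \<Longrightarrow> p \<in> points M \<Longrightarrow> u p \<in> points N"
  unfolding smooth_map_def continuous_map_def by blast

lemma openin_map_preimage:
  assumes "smooth_map M N u" "openin (mtop M) W" "openin (mtop N) V"
  shows "openin (mtop M) (W \<inter> u -` V)"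
proof -
  have "openin (mtop M) {p \<in> points M. u p \<in> V}"
    using assms(1,3) unfolding smooth_map_def continuous_map_def by blast
  then have "openin (mtop M) (W \<inter> {p \<in> points M. u p \<in> V})" using assms(2) by blast
  moreover have "W \<inter> {p \<in> points M. u p \<in> V} = W \<inter> u -` V"
    using openin_subset[OF assms(2)] by blast
  ultimately show ?thesis by simp
qed

lemma open_map_domain:
  assumes "smooth_manifold M" "smooth_manifold N" "smooth_map M N u"
    "c \<in> atlas M" "d \<in> atlas N" "openin (mtop M) W"
  shows "open (snd c ` (fst c \<inter> W \<inter> u -` fst d))"
  by (rule open_chart_image[OF assms(1,4)])
     (use openin_map_preimage[OF assms(3) _ chart_openin[OF assms(2,5)]] chart_openin[OF assms(1,4)]
        assms(6) in auto)

lemma smooth_map_id: "smooth_manifold M \<Longrightarrow> smooth_map M M id"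
  unfolding smooth_map_def smooth_manifold_def transition_def by (auto simp: vimage_def Int_def)

lemma smooth_map_local_rep:
  assumes "smooth_map M N u" "c \<in> atlas M" "d \<in> atlas N"
  shows "smooth_on (snd c ` (fst c \<inter> u -` fst d)) (local_rep c d u)"
  using assms unfolding smooth_map_def local_rep_def by blast

lemma jac_has_derivative:
  assumes "smooth_map M N u" "c \<in> charts_at M p" "d \<in> charts_at N (u p)"
  shows "(local_rep c d u has_derivative jac c d u p) (at (snd c p))"
  unfolding jac_def
  by (rule smooth_on_has_derivative[OF smooth_map_local_rep])
     (use assms in \<open>auto simp: charts_at_def\<close>)

lemma jac_linear:
  assumes "smooth_map M N u" "c \<in> charts_at M p" "d \<in> charts_at N (u p)"
  shows "linear (jac c d u p)"
  using jac_has_derivative[OF assms] has_derivative_linear by blast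

text \<open>\<open>chart_inv d\<close> undoes \<open>snd d\<close> only on the chart domain, so the
  coordinate form of the composite factors only near the point; the open set \<open>?S\<close> is a
  place where it does.\<close>

lemma jac_compose:
  assumes M: "smooth_manifold M" and N: "smooth_manifold N"
    and u: "smooth_map M N u" and w: "smooth_map N P w"
    and c: "c \<in> charts_at M p" and d: "d \<in> charts_at N (u p)" and e: "e \<in> charts_at P (w (u p))"
  shows "jac c e (\<lambda>q. w (u q)) p v = jac d e w (u p) (jac c d u p v)"
proof -
  let ?S = "snd c ` (fst c \<inter> fst c \<inter> u -` fst d)"
  have "local_rep c d u (snd c p) = snd d (u p)"
    by (simp add: local_rep_def chart_inv_chart[OF M charts_atD[OF c]])
  then have "((\<lambda>x. local_rep d e w (local_rep c d u x)) has_derivative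
      (\<lambda>v. jac d e w (u p) (jac c d u p v))) (at (snd c p))"
    using has_derivative_compose[OF jac_has_derivative[OF u c d], of "local_rep d e w"]
      jac_has_derivative[OF w d e] by simp
  moreover have "open ?S"
    by (rule open_map_domain[OF M N u]) (use c d chart_openin[OF M] in \<open>auto simp: charts_at_def\<close>)
  moreover have "snd c p \<in> ?S" using c d by (auto simp: charts_at_def)
  moreover have "local_rep d e w (local_rep c d u x) = local_rep c e (\<lambda>q. w (u q)) x"
    if "x \<in> ?S" for x
    using that chart_inv_chart[OF M charts_atD(1)[OF c]] chart_inv_chart[OF N charts_atD(1)[OF d]]
    by (auto simp: local_rep_def)
  ultimately have "(local_rep c e (\<lambda>q. w (u q)) has_derivative
      (\<lambda>v. jac d e w (u p) (jac c d u p v))) (at (snd c p))"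
    by (rule has_derivative_transform_within_open)
  then show ?thesis unfolding jac_def by (rule frechet_derivative_eqI[THEN fun_cong])
qed

lemma jac_transition_left:
  assumes "smooth_manifold M" "smooth_manifold N" "smooth_map M N u"
    "c \<in> charts_at M p" "d \<in> charts_at N (u p)" "e \<in> charts_at N (u p)"
  shows "jac c e u p v = jac d e id (u p) (jac c d u p v)"
  using jac_compose[OF assms(1,2,3) smooth_map_id[OF assms(2)] assms(4,5), of e v] assms(6) by simp

lemma jac_transition_right:
  assumes "smooth_manifold M" "smooth_manifold N" "smooth_map M N u"
    "c \<in> charts_at M p" "c' \<in> charts_at M p" "d \<in> charts_at N (u p)"
  shows "jac c d u p v = jac c' d u p (jac c c' id p v)"
  using jac_compose[OF assms(1,1) smooth_map_id[OF assms(1)] assms(3,4), of c' d v] assms(5,6) by simp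

lemma jac_id:
  assumes M: "smooth_manifold M" and c: "c \<in> charts_at M p"
  shows "jac c c id p v = v"
proof -
  have "open (snd c ` fst c)"
    using open_chart_image[OF M _ chart_openin[OF M]] c by (auto simp: charts_at_def)
  then have "frechet_derivative (\<lambda>x. x) (at (snd c p)) = frechet_derivative (local_rep c c id) (at (snd c p))"
    by (rule frechet_derivative_cong_open)
       (use chart_inv_chart[OF M, of c] c in \<open>auto simp: charts_at_def local_rep_def\<close>)
  then show ?thesis by (metis jac_def frechet_derivative_ident)
qed

section \<open>Tangent vectors\<close>

lemma tangent_space_iff:
  "v \<in> tangent_space M p \<longleftrightarrow>
     (\<forall>c\<in>charts_at M p. \<forall>d\<in>charts_at M p. v d = jac c d id p (v c)) \<and>
     (\<forall>c. c \<notin> charts_at M p \<longrightarrow> v c = 0)"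
  by (simp only: tangent_space_def jac_def transition_def local_rep_def mem_Collect_eq id_apply)

lemma tangent_transform:
  "v \<in> tangent_space M p \<Longrightarrow> c \<in> charts_at M p \<Longrightarrow> d \<in> charts_at M p \<Longrightarrow> v d = jac c d id p (v c)"
  unfolding tangent_space_iff by (elim conjE) (drule bspec, assumption)+

lemma tangent_outside: "v \<in> tangent_space M p \<Longrightarrow> c \<notin> charts_at M p \<Longrightarrow> v c = 0"
  unfolding tangent_space_iff by (elim conjE allE impE)

text \<open>One coordinate vector determines those in the other charts at \<open>p\<close> by the
  transformation rule, and at all remaining indices the family is 0.\<close>

lemma tangent_eqI:
  assumes "v \<in> tangent_space M p" "w \<in> tangent_space M p" "c \<in> charts_at M p" "v c = w c"
  shows "v = w"
proof
  fix d show "v d = w d"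
  proof (cases "d \<in> charts_at M p")
    case True
    then show ?thesis
      using tangent_transform[OF assms(1,3) True] tangent_transform[OF assms(2,3) True] assms(4) by simp
  qed (simp add: tangent_outside[OF assms(1)] tangent_outside[OF assms(2)])
qed

lemma jac_id_linear:
  "smooth_manifold M \<Longrightarrow> c \<in> charts_at M p \<Longrightarrow> d \<in> charts_at M p \<Longrightarrow> linear (jac c d id p)"
  using jac_linear[OF smooth_map_id, of M c p d] by simp

lemma tangent_zero: "smooth_manifold M \<Longrightarrow> 0 \<in> tangent_space M p"
  unfolding tangent_space_iff by (simp add: linear_0[OF jac_id_linear])

lemma tangent_add:
  assumes M: "smooth_manifold M" and v: "v \<in> tangent_space M p" and w: "w \<in> tangent_space M p"
  shows "v + w \<in> tangent_space M p"
  unfolding tangent_space_iff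
proof (intro conjI ballI allI impI)
  fix c d assume "c \<in> charts_at M p" "d \<in> charts_at M p"
  then show "(v + w) d = jac c d id p ((v + w) c)"
    using tangent_transform[OF v, of c d] tangent_transform[OF w, of c d]
    by (simp add: linear_add[OF jac_id_linear[OF M]])
qed (simp add: tangent_outside[OF v] tangent_outside[OF w])

lemma tangent_scale:
  assumes M: "smooth_manifold M" and v: "v \<in> tangent_space M p"
  shows "tscale r v \<in> tangent_space M p"
  unfolding tangent_space_iff
proof (intro conjI ballI allI impI)
  fix c d assume "c \<in> charts_at M p" "d \<in> charts_at M p"
  then show "tscale r v d = jac c d id p (tscale r v c)"
    using tangent_transform[OF v, of c d]
    by (simp add: tscale_def linear_scale[OF jac_id_linear[OF M]])
qed (simp add: tscale_def tangent_outside[OF v])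

text \<open>The axioms for \<open>J\<close>, the metric and connections speak of addition and
  \<open>tscale\<close>; sign rules are obtained from them through the factor -1.\<close>

lemma tscale_minus_one: "tscale (-1) v = - v"
  by (auto simp: tscale_def)

lemma tangent_minus: "smooth_manifold M \<Longrightarrow> v \<in> tangent_space M p \<Longrightarrow> - v \<in> tangent_space M p"
  using tangent_scale[of M v p "-1"] by (simp add: tscale_minus_one)

lemma tangent_diff:
  "smooth_manifold M \<Longrightarrow> v \<in> tangent_space M p \<Longrightarrow> w \<in> tangent_space M p \<Longrightarrow> v - w \<in> tangent_space M p"
  using tangent_add[of M v p "- w"] tangent_minus by fastforce

lemma tangent_sum:
  assumes "smooth_manifold M" "\<And>i. i \<in> I \<Longrightarrow> v i \<in> tangent_space M p"
  shows "(\<Sum>i\<in>I. v i) \<in> tangent_space M p"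
  using assms(2)
  by (induction I rule: infinite_finite_induct) (auto intro: tangent_zero tangent_add assms(1))

lemma sum_fun_apply: "(\<Sum>i\<in>I. f i) x = (\<Sum>i\<in>I. f i x)"
  by (induction I rule: infinite_finite_induct) auto

text \<open>The vector field with constant coordinate vector \<open>z\<close> in the chart \<open>d\<close>.\<close>

definition coord_field ::
  "('m, 'a::euclidean_space) manifold \<Rightarrow> ('m, 'a) chart \<Rightarrow> 'a \<Rightarrow> 'm \<Rightarrow> ('m, 'a) tvec" where
  "coord_field M d z p = (\<lambda>e. if e \<in> charts_at M p then jac d e id p z else 0)"

lemma coord_field_tangent:
  assumes "smooth_manifold M" "d \<in> charts_at M p"
  shows "coord_field M d z p \<in> tangent_space M p"
  unfolding tangent_space_iff
proof (intro conjI ballI allI impI)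
  fix c e assume "c \<in> charts_at M p" "e \<in> charts_at M p"
  then show "coord_field M d z p e = jac c e id p (coord_field M d z p c)"
    using jac_transition_left[OF assms(1,1) smooth_map_id[OF assms(1)] assms(2), of c e z]
    by (simp add: coord_field_def)
qed (simp add: coord_field_def)

lemma coord_field_self:
  "smooth_manifold M \<Longrightarrow> d \<in> charts_at M p \<Longrightarrow> coord_field M d z p d = z"
  by (simp add: coord_field_def jac_id)

text \<open>Extends a tangent vector to a vector field on the chart domain, so that identities
  stated for fields can be read off at arbitrary vectors.\<close>

lemma coord_field_eq:
  "smooth_manifold M \<Longrightarrow> d \<in> charts_at M p \<Longrightarrow> v \<in> tangent_space M p \<Longrightarrow> coord_field M d (v d) p = v"
  by (metis coord_field_self coord_field_tangent tangent_eqI)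

lemma tangent_frame_expansion:
  assumes M: "smooth_manifold M" and d: "d \<in> charts_at M p" and v: "v \<in> tangent_space M p"
  shows "v = (\<Sum>b\<in>Basis. tscale (v d \<bullet> b) (coord_field M d b p))"
proof (rule tangent_eqI[OF v _ d])
  show "(\<Sum>b\<in>Basis. tscale (v d \<bullet> b) (coord_field M d b p)) \<in> tangent_space M p"
    by (intro tangent_sum tangent_scale coord_field_tangent M d)
  show "v d = (\<Sum>b\<in>Basis. tscale (v d \<bullet> b) (coord_field M d b p)) d"
    by (simp add: sum_fun_apply tscale_def coord_field_self[OF M d] euclidean_representation)
qed

text \<open>The definition uses the chosen \<open>chart_at M p\<close>; the transformation rule of
  \<open>v\<close> and the chain rule allow any other chart in its place.\<close>

lemma differential_in_chart:
  assumes M: "smooth_manifold M" and N: "smooth_manifold N" and u: "smooth_map M N u"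
    and v: "v \<in> tangent_space M p" and c: "c \<in> charts_at M p" and d: "d \<in> charts_at N (u p)"
  shows "differential M N u p v d = jac c d u p (v c)"
proof -
  have c0: "chart_at M p \<in> charts_at M p"
    by (rule chart_at_in[OF M charts_at_point[OF M c]])
  have "differential M N u p v d = jac (chart_at M p) d u p (v (chart_at M p))"
    using d by (simp add: differential_def jac_def local_rep_def Let_def)
  also have "\<dots> = jac c d u p (v c)"
    using jac_transition_right[OF M N u c0 c d] tangent_transform[OF v c0 c] by metis
  finally show ?thesis .
qed

lemma differential_in_chart_at:
  "d \<in> charts_at N (u p) \<Longrightarrow> differential M N u p v d = jac (chart_at M p) d u p (v (chart_at M p))"
  by (simp add: differential_def jac_def local_rep_def Let_def)

lemma differential_tangent:
  assumes M: "smooth_manifold M" and N: "smooth_manifold N" and u: "smooth_map M N u"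
    and p: "p \<in> points M"
  shows "differential M N u p v \<in> tangent_space N (u p)"
  unfolding tangent_space_iff
proof (intro conjI ballI allI impI)
  fix c e assume "c \<in> charts_at N (u p)" "e \<in> charts_at N (u p)"
  then show "differential M N u p v e = jac c e id (u p) (differential M N u p v c)"
    using jac_transition_left[OF M N u chart_at_in[OF M p], of c e] by (simp add: differential_in_chart_at)
qed (simp add: differential_def)

lemma differential_outside: "d \<notin> charts_at N (u p) \<Longrightarrow> differential M N u p v d = 0"
  by (simp add: differential_def)

lemma
  assumes M: "smooth_manifold M" and u: "smooth_map M N u" and p: "p \<in> points M"
  shows differential_add: "differential M N u p (v + w) = differential M N u p v + differential M N u p w"
    and differential_diff: "differential M N u p (v - w) = differential M N u p v - differential M N u p w"
    and differential_minus: "differential M N u p (- v) = - differential M N u p v"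
proof -
  have lin: "linear (jac (chart_at M p) d u p)" if "d \<in> charts_at N (u p)" for d
    by (rule jac_linear[OF u chart_at_in[OF M p] that])
  have "differential M N u p (v + w) d = (differential M N u p v + differential M N u p w) d"
    "differential M N u p (v - w) d = (differential M N u p v - differential M N u p w) d"
    "differential M N u p (- v) d = (- differential M N u p v) d" for d
    by (cases "d \<in> charts_at N (u p)";
        simp add: differential_in_chart_at differential_outside lin linear_add linear_diff linear_neg)+
  then show "differential M N u p (v + w) = differential M N u p v + differential M N u p w"
    "differential M N u p (v - w) = differential M N u p v - differential M N u p w"
    "differential M N u p (- v) = - differential M N u p v" by blast+
qed

lemma differential_id:
  assumes "smooth_manifold M" "p \<in> points M" "v \<in> tangent_space M p"
  shows "differential M M id p v = v"
proof -
  have c: "chart_at M p \<in> charts_at M p" by (rule chart_at_in[OF assms(1,2)])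
  have "differential M M id p v \<in> tangent_space M p"
    using differential_tangent[OF assms(1,1) smooth_map_id[OF assms(1)] assms(2)] by simp
  then show ?thesis
    using assms c by (intro tangent_eqI[OF _ assms(3) c])
      (simp_all add: differential_in_chart_at jac_id)
qed

section \<open>Sections\<close>

lemma section_along_tangent: "section_along M N u W s \<Longrightarrow> p \<in> W \<Longrightarrow> s p \<in> tangent_space N (u p)"
  by (simp add: section_along_def)

lemma vector_field_tangent: "vector_field M W X \<Longrightarrow> p \<in> W \<Longrightarrow> X p \<in> tangent_space M p"
  using section_along_tangent[of M M id W X p] by simp

lemma section_along_smooth:
  "section_along M N u W s \<Longrightarrow> c \<in> atlas M \<Longrightarrow> d \<in> atlas N \<Longrightarrow>
    smooth_on (snd c ` (fst c \<inter> W \<inter> u -` fst d)) (\<lambda>x. s (chart_inv c x) d)"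
  by (simp add: section_along_def)

lemma section_along_subset: "section_along M N u W s \<Longrightarrow> W' \<subseteq> W \<Longrightarrow> section_along M N u W' s"
  unfolding section_along_def by (blast intro: smooth_on_subset)

lemma smooth_function_const: "smooth_function M W (\<lambda>q. r)"
  by (simp add: smooth_function_def smooth_on_const)

context
  fixes M :: "('m, 'a::euclidean_space) manifold" and N :: "('n, 'b::euclidean_space) manifold"
    and u :: "'m \<Rightarrow> 'n"
  assumes M: "smooth_manifold M" and N: "smooth_manifold N" and u: "smooth_map M N u"
begin

lemma section_along_cong:
  assumes W: "openin (mtop M) W" and s: "section_along M N u W s" and eq: "\<And>q. q \<in> W \<Longrightarrow> s q = t q"
  shows "section_along M N u W t"
  unfolding section_along_def
proof (intro conjI ballI)
  show "t p \<in> tangent_space N (u p)" if "p \<in> W" for p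
    using s eq that by (metis section_along_tangent)
  fix c d assume c: "c \<in> atlas M" and d: "d \<in> atlas N"
  show "smooth_on (snd c ` (fst c \<inter> W \<inter> u -` fst d)) (\<lambda>x. t (chart_inv c x) d)"
    by (rule smooth_on_cong[OF open_map_domain[OF M N u c d W] section_along_smooth[OF s c d]])
       (use eq chart_inv_chart[OF M c] in auto)
qed

lemma section_along_zero: "section_along M N u W (\<lambda>q. 0)"
  unfolding section_along_def using tangent_zero[OF N] by (auto intro: smooth_on_const)

lemma section_along_add:
  assumes "openin (mtop M) W" "section_along M N u W s" "section_along M N u W t"
  shows "section_along M N u W (\<lambda>q. s q + t q)"
  using assms unfolding section_along_def
  by (auto intro!: tangent_add[OF N] smooth_on_add open_map_domain[OF M N u])

lemma section_along_scale:
  assumes "openin (mtop M) W" "smooth_function M W f" "section_along M N u W s"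
  shows "section_along M N u W (\<lambda>q. tscale (f q) (s q))"
  unfolding section_along_def
proof (intro conjI ballI)
  show "tscale (f p) (s p) \<in> tangent_space N (u p)" if "p \<in> W" for p
    using section_along_tangent[OF assms(3) that] by (rule tangent_scale[OF N])
  fix c d assume c: "c \<in> atlas M" and d: "d \<in> atlas N"
  have "smooth_on (snd c ` (fst c \<inter> W \<inter> u -` fst d)) (\<lambda>x. f (chart_inv c x))"
    using assms(2) c unfolding smooth_function_def by (blast intro: smooth_on_subset)
  then show "smooth_on (snd c ` (fst c \<inter> W \<inter> u -` fst d)) (\<lambda>x. tscale (f (chart_inv c x)) (s (chart_inv c x)) d)"
    unfolding tscale_def
    by (intro smooth_on_scaleR open_map_domain[OF M N u c d assms(1)] section_along_smooth[OF assms(3) c d])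
qed

lemma section_along_minus:
  "openin (mtop M) W \<Longrightarrow> section_along M N u W s \<Longrightarrow> section_along M N u W (\<lambda>q. - s q)"
  using section_along_scale[of W "\<lambda>q. -1" s] by (simp add: smooth_function_const tscale_minus_one)

lemma section_along_sum:
  assumes "openin (mtop M) W" "\<And>i. i \<in> I \<Longrightarrow> section_along M N u W (s i)"
  shows "section_along M N u W (\<lambda>q. \<Sum>i\<in>I. s i q)"
  using assms(2)
  by (induction I rule: infinite_finite_induct)
     (auto intro: section_along_zero section_along_add assms(1))

lemma section_along_coefficient:
  assumes W: "openin (mtop M) W" and s: "section_along M N u W s" and d: "d \<in> atlas N"
  shows "smooth_function M (W \<inter> u -` fst d) (\<lambda>q. s q d \<bullet> b)"
  unfolding smooth_function_def
proof
  fix c assume c: "c \<in> atlas M"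
  have "fst c \<inter> (W \<inter> u -` fst d) = fst c \<inter> W \<inter> u -` fst d" by blast
  then show "smooth_on (snd c ` (fst c \<inter> (W \<inter> u -` fst d))) (\<lambda>x. s (chart_inv c x) d \<bullet> b)"
    using smooth_on_inner[OF open_map_domain[OF M N u c d W] section_along_smooth[OF s c d]] by simp
qed

lemma section_along_compose:
  assumes V: "openin (mtop N) V" and Y: "vector_field N V Y" and W: "openin (mtop M) W"
  shows "section_along M N u (W \<inter> u -` V) (\<lambda>q. Y (u q))"
  unfolding section_along_def
proof (intro conjI ballI)
  show "Y (u p) \<in> tangent_space N (u p)" if "p \<in> W \<inter> u -` V" for p
    using vector_field_tangent[OF Y] that by simp
  fix c d assume c: "c \<in> atlas M" and d: "d \<in> atlas N"
  let ?S = "snd c ` (fst c \<inter> (W \<inter> u -` V) \<inter> u -` fst d)"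
    and ?T = "snd d ` (fst d \<inter> V \<inter> id -` fst d)"
  have S: "open ?S" by (rule open_map_domain[OF M N u c d openin_map_preimage[OF u W V]])
  have T: "open ?T" by (rule open_map_domain[OF N N smooth_map_id[OF N] d d V])
  show "smooth_on ?S (\<lambda>x. Y (u (chart_inv c x)) d)"
  proof (rule smooth_on_cong[OF S smooth_on_compose[OF S T]])
    show "local_rep c d u ` ?S \<subseteq> ?T"
      using chart_inv_chart[OF M c] by (auto simp: local_rep_def)
    show "smooth_on ?S (local_rep c d u)"
      by (rule smooth_on_subset[OF smooth_map_local_rep[OF u c d]]) blast
    show "smooth_on ?T (\<lambda>y. Y (chart_inv d y) d)"
      by (rule section_along_smooth[OF Y d d])
    show "Y (chart_inv d (local_rep c d u x)) d = Y (u (chart_inv c x)) d" if "x \<in> ?S" for x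
      using that chart_inv_chart[OF M c] chart_inv_chart[OF N d] by (auto simp: local_rep_def)
  qed
qed

text \<open>\<open>chart_at\<close> may jump from point to point, so before the differential of a
  field can itself be differentiated it has to be written in one fixed chart
  \<open>c\<close>.\<close>

lemma differential_local:
  assumes X: "vector_field M W X" and c: "c \<in> atlas M" and d: "d \<in> atlas N"
    and x: "x \<in> snd c ` (fst c \<inter> W \<inter> u -` fst d)"
  shows "differential M N u (chart_inv c x) (X (chart_inv c x)) d =
    frechet_derivative (local_rep c d u) (at x) (X (chart_inv c x) c)"
proof -
  obtain q where q: "q \<in> fst c" "q \<in> W" "u q \<in> fst d" "x = snd c q" using x by auto
  then show ?thesis
    using differential_in_chart[OF M N u vector_field_tangent[OF X], of q c d] c d
    by (simp add: chart_inv_chart[OF M c] charts_at_def jac_def)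
qed

lemma vector_field_smooth:
  assumes "vector_field M W X" "c \<in> atlas M"
  shows "smooth_on (snd c ` (fst c \<inter> W)) (\<lambda>x. X (chart_inv c x) c)"
  using section_along_smooth[OF assms assms(2)] by (rule smooth_on_subset) auto

lemma section_along_differential:
  assumes W: "openin (mtop M) W" and X: "vector_field M W X"
  shows "section_along M N u W (\<lambda>q. differential M N u q (X q))"
  unfolding section_along_def
proof (intro conjI ballI)
  show "differential M N u p (X p) \<in> tangent_space N (u p)" if "p \<in> W" for p
    using differential_tangent[OF M N u] openin_subset[OF W] that by blast
  fix c d assume c: "c \<in> atlas M" and d: "d \<in> atlas N"
  let ?S = "snd c ` (fst c \<inter> W \<inter> u -` fst d)"
  have S: "open ?S" by (rule open_map_domain[OF M N u c d W])
  show "smooth_on ?S (\<lambda>x. differential M N u (chart_inv c x) (X (chart_inv c x)) d)"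
  proof (rule smooth_on_cong[OF S smooth_on_frechet_derivative_apply[OF S]])
    show "smooth_on ?S (local_rep c d u)"
      by (rule smooth_on_subset[OF smooth_map_local_rep[OF u c d]]) blast
    show "smooth_on ?S (\<lambda>x. X (chart_inv c x) c)"
      by (rule smooth_on_subset[OF vector_field_smooth[OF X c]]) blast
  qed (simp add: differential_local[OF X c d])
qed

end

text \<open>In a chart \<open>e\<close> the field is the derivative in the fixed direction
  \<open>z\<close> of the transition from \<open>d\<close> to \<open>e\<close>, evaluated after the
  transition from \<open>c\<close> to \<open>d\<close>; both are smooth.\<close>

lemma coord_field_vector_field:
  assumes M: "smooth_manifold M" and d: "d \<in> atlas M"
  shows "vector_field M (fst d) (coord_field M d z)"
  unfolding section_along_def
proof (intro conjI ballI)
  show "coord_field M d z p \<in> tangent_space M (id p)" if "p \<in> fst d" for p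
    using coord_field_tangent[OF M] d that by (simp add: charts_at_def)
  fix c e assume c: "c \<in> atlas M" and e: "e \<in> atlas M"
  let ?S = "snd c ` (fst c \<inter> fst d \<inter> id -` fst e)" and ?T = "snd d ` (fst d \<inter> id -` fst e)"
  have S: "open ?S"
    by (rule open_map_domain[OF M M smooth_map_id[OF M] c e chart_openin[OF M d]])
  have T: "open ?T"
    using open_map_domain[OF M M smooth_map_id[OF M] d e chart_openin[OF M d]] by simp
  show "smooth_on ?S (\<lambda>x. coord_field M d z (chart_inv c x) e)"
  proof (rule smooth_on_cong[OF S smooth_on_compose[OF S T]])
    show "local_rep c d id ` ?S \<subseteq> ?T"
      using chart_inv_chart[OF M c] by (auto simp: local_rep_def)
    show "smooth_on ?S (local_rep c d id)"
      by (rule smooth_on_subset[OF smooth_map_local_rep[OF smooth_map_id[OF M] c d]]) auto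
    show "smooth_on ?T (\<lambda>y. frechet_derivative (local_rep d e id) (at y) z)"
      by (rule smooth_on_frechet_derivative[OF smooth_map_local_rep[OF smooth_map_id[OF M] d e]])
    show "frechet_derivative (local_rep d e id) (at (local_rep c d id x)) z =
        coord_field M d z (chart_inv c x) e" if "x \<in> ?S" for x
      using that e chart_inv_chart[OF M c]
      by (auto simp: local_rep_def coord_field_def charts_at_def jac_def)
  qed
qed

section \<open>Connections along maps\<close>

lemma
  assumes E: "connection_along M N u E" and W: "openin (mtop M) W" and s: "section_along M N u W s"
    and p: "p \<in> W" and v: "v \<in> tangent_space M p"
  shows connection_tangent: "E p v s \<in> tangent_space N (u p)"
    and connection_scale_dir: "E p (tscale r v) s = tscale r (E p v s)"
    and connection_add: "section_along M N u W t \<Longrightarrow> E p v (\<lambda>q. s q + t q) = E p v s + E p v t"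
    and connection_cong: "section_along M N u W t \<Longrightarrow> (\<And>q. q \<in> W \<Longrightarrow> s q = t q) \<Longrightarrow> E p v s = E p v t"
    and connection_leibniz: "smooth_function M W f \<Longrightarrow> E p v (\<lambda>q. tscale (f q) (s q)) =
      tscale (dir_deriv M p v f) (s p) + tscale (f p) (E p v s)"
proof -
  note A = E[unfolded connection_along_def, THEN spec, THEN spec, THEN mp, OF W, THEN mp, OF s]
  note B = A[THEN conjunct1, THEN bspec, OF p, THEN bspec, OF v]
  show "E p v s \<in> tangent_space N (u p)" by (rule B[THEN conjunct1])
  show "E p (tscale r v) s = tscale r (E p v s)"
    by (rule B[THEN conjunct2, THEN conjunct1, THEN spec])
  note C = B[THEN conjunct2, THEN conjunct2, THEN conjunct2]
  show "E p v (\<lambda>q. s q + t q) = E p v s + E p v t" if "section_along M N u W t"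
    by (rule C[THEN conjunct1, THEN spec, THEN mp, OF that, THEN conjunct1])
  show "E p v s = E p v t" if "section_along M N u W t" "\<And>q. q \<in> W \<Longrightarrow> s q = t q"
    by (rule C[THEN conjunct1, THEN spec, THEN mp, OF that(1), THEN conjunct2, THEN mp])
       (use that(2) in blast)
  show "E p v (\<lambda>q. tscale (f q) (s q)) = tscale (dir_deriv M p v f) (s p) + tscale (f p) (E p v s)"
    if "smooth_function M W f"
    by (rule C[THEN conjunct2, THEN spec, THEN mp, OF that])
qed

lemma connection_minus_dir:
  assumes "connection_along M N u E" "openin (mtop M) W" "section_along M N u W s"
    "p \<in> W" "v \<in> tangent_space M p"
  shows "E p (- v) s = - E p v s"
  using connection_scale_dir[OF assms, of "-1"] by (simp add: tscale_minus_one)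

lemma tscale_zero_left: "tscale 0 v = 0"
  and tscale_diff_left: "tscale (r - r') v = tscale r v - tscale r' v"
  by (auto simp: tscale_def scaleR_diff_left)

context
  fixes M :: "('m, 'a::euclidean_space) manifold" and N :: "('n, 'b::euclidean_space) manifold"
    and u :: "'m \<Rightarrow> 'n" and E :: "('m, 'a, 'n, 'b) conn_along"
  assumes M: "smooth_manifold M" and N: "smooth_manifold N" and u: "smooth_map M N u"
    and E: "connection_along M N u E"
begin

text \<open>This is the Leibniz rule for the constant function -1, whose derivative is zero.\<close>

lemma connection_minus:
  assumes W: "openin (mtop M) W" and s: "section_along M N u W s" and p: "p \<in> W"
    and v: "v \<in> tangent_space M p"
  shows "E p v (\<lambda>q. - s q) = - E p v s"
proof -
  have "dir_deriv M p v (\<lambda>q. -1) = 0" by (simp add: dir_deriv_def)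
  then show ?thesis
    using connection_leibniz[OF E W s p v smooth_function_const[of M W "-1"]]
    by (simp add: tscale_minus_one tscale_zero_left)
qed

lemma connection_sum:
  assumes W: "openin (mtop M) W" and s: "\<And>i. i \<in> I \<Longrightarrow> section_along M N u W (s i)" and p: "p \<in> W"
    and v: "v \<in> tangent_space M p"
  shows "E p v (\<lambda>q. \<Sum>i\<in>I. s i q) = (\<Sum>i\<in>I. E p v (s i))"
  using s
proof (induction I rule: infinite_finite_induct)
  case (insert i I)
  have "section_along M N u W (\<lambda>q. \<Sum>i\<in>I. s i q)"
    by (rule section_along_sum[OF M N u W]) (use insert.prems in auto)
  then have "E p v (\<lambda>q. s i q + (\<Sum>i\<in>I. s i q)) = E p v (s i) + E p v (\<lambda>q. \<Sum>i\<in>I. s i q)"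
    by (intro connection_add[OF E W _ p v]) (use insert.prems in auto)
  then show ?case
    by (simp only: sum.insert[OF insert.hyps] insert.IH[OF insert.prems[OF insertI2]])
\<comment> \<open>For an empty or infinite \<open>I\<close> the section is zero, and additivity on 0
  + 0 forces its derivative to vanish.\<close>
qed (use connection_add[OF E W section_along_zero[OF M N u] p v section_along_zero[OF M N u]] in simp_all)

lemma connection_leibniz_sum:
  assumes W: "openin (mtop M) W" and t: "section_along M N u W t" and p: "p \<in> W"
    and v: "v \<in> tangent_space M p"
    and f: "\<And>i. i \<in> I \<Longrightarrow> smooth_function M W (f i)"
    and s: "\<And>i. i \<in> I \<Longrightarrow> section_along M N u W (s i)"
    and eq: "\<And>q. q \<in> W \<Longrightarrow> t q = (\<Sum>i\<in>I. tscale (f i q) (s i q))"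
  shows "E p v t = (\<Sum>i\<in>I. tscale (dir_deriv M p v (f i)) (s i p) + tscale (f i p) (E p v (s i)))"
proof -
  have fs: "section_along M N u W (\<lambda>q. tscale (f i q) (s i q))" if "i \<in> I" for i
    by (rule section_along_scale[OF M N u W f[OF that] s[OF that]])
  have "E p v t = E p v (\<lambda>q. \<Sum>i\<in>I. tscale (f i q) (s i q))"
    by (rule connection_cong[OF E W t p v section_along_sum[OF M N u W fs] eq])
  also have "\<dots> = (\<Sum>i\<in>I. E p v (\<lambda>q. tscale (f i q) (s i q)))"
    by (rule connection_sum[OF W fs p v])
  also have "\<dots> = (\<Sum>i\<in>I. tscale (dir_deriv M p v (f i)) (s i p) + tscale (f i p) (E p v (s i)))"
    by (rule sum.cong[OF refl]) (rule connection_leibniz[OF E W s p v f])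
  finally show ?thesis .
qed

text \<open>Where \<open>u\<close> lands in the domain of \<open>d\<close>, any section along
  \<open>u\<close> is a combination of pulled-back coordinate fields with smooth coefficients. On
  these fields an induced connection is given by its chain rule, so this expansion makes it
  computable.\<close>

lemma connection_frame_expansion:
  assumes W: "openin (mtop M) W" and s: "section_along M N u W s" and p: "p \<in> W"
    and v: "v \<in> tangent_space M p" and d: "d \<in> charts_at N (u p)"
  shows "E p v s = (\<Sum>b\<in>Basis. tscale (dir_deriv M p v (\<lambda>q. s q d \<bullet> b)) (coord_field N d b (u p))
    + tscale (s p d \<bullet> b) (E p v (\<lambda>q. coord_field N d b (u q))))"
proof (rule connection_leibniz_sum[of "W \<inter> u -` fst d"])
  show "openin (mtop M) (W \<inter> u -` fst d)"
    by (rule openin_map_preimage[OF u W chart_openin[OF N charts_atD(1)[OF d]]])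
  show "section_along M N u (W \<inter> u -` fst d) s" by (rule section_along_subset[OF s]) blast
  show "smooth_function M (W \<inter> u -` fst d) (\<lambda>q. s q d \<bullet> b)" for b
    by (rule section_along_coefficient[OF M N u W s charts_atD(1)[OF d]])
  show "section_along M N u (W \<inter> u -` fst d) (\<lambda>q. coord_field N d b (u q))" for b
    by (rule section_along_compose[OF M N u chart_openin[OF N] coord_field_vector_field[OF N] W];
        rule charts_atD(1)[OF d])
  show "s q = (\<Sum>b\<in>Basis. tscale (s q d \<bullet> b) (coord_field N d b (u q)))" if "q \<in> W \<inter> u -` fst d" for q
    using that charts_atD(1)[OF d]
    by (intro tangent_frame_expansion[OF N] section_along_tangent[OF s]) (auto simp: charts_at_def)
qed (use p v charts_atD(2)[OF d] in auto)

end

section \<open>Induced connections and their torsion\<close>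

lemma induced_connection_along: "induced_connection M N u D E \<Longrightarrow> connection_along M N u E"
  by (simp add: induced_connection_def)

lemma induced_connection_chain:
  assumes "induced_connection M N u D E" "openin (mtop N) V" "vector_field N V Y"
    "p \<in> points M" "u p \<in> V" "v \<in> tangent_space M p"
  shows "E p v (\<lambda>q. Y (u q)) = D (u p) (differential M N u p v) Y"
  using assms unfolding induced_connection_def by simp

text \<open>The torsion of \<open>D\<close> on two fields with constant coordinates in the chart \<open>d\<close>. These
  have vanishing bracket, so it is the torsion tensor of \<open>D\<close>.\<close>

definition frame_torsion ::
  "('n, 'b::euclidean_space) manifold \<Rightarrow> ('n, 'b) conn \<Rightarrow> ('n, 'b) chart \<Rightarrow> 'n
     \<Rightarrow> ('n, 'b) tvec \<Rightarrow> ('n, 'b) tvec \<Rightarrow> ('n, 'b) tvec" where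
  "frame_torsion N D d q w z =
     (\<Sum>b\<in>Basis. tscale (z d \<bullet> b) (D q w (coord_field N d b)) - tscale (w d \<bullet> b) (D q z (coord_field N d b)))"

text \<open>Brings the derivative of a coefficient of \<open>du Y\<close> into the shape required by
  \<open>frechet_derivative_bracket\<close>. The chart is \<open>chart_at M p\<close> because
  \<open>dir_deriv\<close> is computed there.\<close>

lemma dir_deriv_differential_coefficient:
  assumes M: "smooth_manifold M" and N: "smooth_manifold N" and u: "smooth_map M N u"
    and W: "openin (mtop M) W" and Y: "vector_field M W Y" and p: "p \<in> W"
    and d: "d \<in> charts_at N (u p)" and c: "c = chart_at M p"
  shows "dir_deriv M p v (\<lambda>q. differential M N u q (Y q) d \<bullet> b) =
    frechet_derivative (\<lambda>x. frechet_derivative (local_rep c d u) (at x) (Y (chart_inv c x) c))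
      (at (snd c p)) (v c) \<bullet> b"
proof -
  have cp: "c \<in> charts_at M p"
    unfolding c using chart_at_in[OF M] openin_subset[OF W] p by blast
  let ?S = "snd c ` (fst c \<inter> W \<inter> u -` fst d)"
  let ?F = "\<lambda>x. frechet_derivative (local_rep c d u) (at x) (Y (chart_inv c x) c)"
  have S: "open ?S"
    by (rule open_map_domain[OF M N u charts_atD(1)[OF cp] charts_atD(1)[OF d] W])
  have pS: "snd c p \<in> ?S" using p charts_atD(2)[OF cp] charts_atD(2)[OF d] by blast
  have F: "smooth_on ?S ?F"
  proof (rule smooth_on_frechet_derivative_apply[OF S])
    show "smooth_on ?S (local_rep c d u)"
      by (rule smooth_on_subset[OF smooth_map_local_rep[OF u charts_atD(1)[OF cp] charts_atD(1)[OF d]]]) blast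
    show "smooth_on ?S (\<lambda>x. Y (chart_inv c x) c)"
      by (rule smooth_on_subset[OF vector_field_smooth[OF M M smooth_map_id[OF M] Y charts_atD(1)[OF cp]]]) blast
  qed
  have "dir_deriv M p v (\<lambda>q. differential M N u q (Y q) d \<bullet> b) =
      frechet_derivative (\<lambda>x. differential M N u (chart_inv c x) (Y (chart_inv c x)) d \<bullet> b) (at (snd c p)) (v c)"
    by (simp add: dir_deriv_def Let_def c)
  also have "\<dots> = frechet_derivative (\<lambda>x. ?F x \<bullet> b) (at (snd c p)) (v c)"
    by (rule arg_cong[where f="\<lambda>F. F (v c)"], rule frechet_derivative_cong_open[OF S pS])
       (simp only: differential_local[OF M N u Y charts_atD(1)[OF cp] charts_atD(1)[OF d]])
  also have "\<dots> = frechet_derivative ?F (at (snd c p)) (v c) \<bullet> b"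
    by (rule fun_cong[OF frechet_derivative_eqI])
       (rule bounded_linear.has_derivative[OF bounded_linear_inner_left smooth_on_has_derivative[OF F pS]])
  finally show ?thesis .
qed

text \<open>The frame expansion splits the left side in two: the differentiated coefficients give
  the image of the bracket, and the derivatives of the frame, taken by \<open>D\<close> in
  \<open>N\<close>, assemble to \<open>frame_torsion\<close>.\<close>

lemma induced_connection_torsion:
  assumes M: "smooth_manifold M" and N: "smooth_manifold N" and u: "smooth_map M N u"
    and E: "induced_connection M N u D E" and W: "openin (mtop M) W"
    and X: "vector_field M W X" and Y: "vector_field M W Y" and p: "p \<in> W"
    and d: "d \<in> charts_at N (u p)"
  shows "E p (X p) (\<lambda>q. differential M N u q (Y q)) - E p (Y p) (\<lambda>q. differential M N u q (X q)) =
    differential M N u p (lie_bracket M X Y p)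
    + frame_torsion N D d (u p) (differential M N u p (X p)) (differential M N u p (Y p))"
proof -
  note d' = charts_atD[OF d]
  have pM: "p \<in> points M" using openin_subset[OF W] p by blast
  define c where "c = chart_at M p"
  have c: "c \<in> charts_at M p" unfolding c_def by (rule chart_at_in[OF M pM])
  let ?F = "\<lambda>b. coord_field N d b"
  let ?du = "\<lambda>Y q. differential M N u q (Y q)"
  let ?\<delta> = "\<lambda>X Y b. dir_deriv M p (X p) (\<lambda>q. ?du Y q d \<bullet> b)"
  have expand: "E p (X p) (?du Y) = (\<Sum>b\<in>Basis. tscale (?\<delta> X Y b) (?F b (u p)))
      + (\<Sum>b\<in>Basis. tscale (?du Y p d \<bullet> b) (D (u p) (?du X p) (?F b)))"
    if X: "vector_field M W X" and Y: "vector_field M W Y" for X Y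
  proof -
    have "E p (X p) (\<lambda>q. ?F b (u q)) = D (u p) (?du X p) (?F b)" for b
      by (rule induced_connection_chain[OF E chart_openin[OF N d'(1)] coord_field_vector_field[OF N d'(1)] pM
            d'(2) vector_field_tangent[OF X p]])
    then show ?thesis
      using connection_frame_expansion[OF M N u induced_connection_along[OF E] W
          section_along_differential[OF M N u W Y] p vector_field_tangent[OF X p] d]
      by (simp add: sum.distrib)
  qed
  let ?S = "snd c ` (fst c \<inter> W \<inter> u -` fst d)"
  \<comment> \<open>In charts \<open>du X\<close> and \<open>du Y\<close> are the Jacobian of
    \<open>u\<close> applied to the fields, so the second derivatives of
    \<open>local_rep c d u\<close> cancel in the difference.\<close>
  have bracket: "?\<delta> X Y b - ?\<delta> Y X b = differential M N u p (lie_bracket M X Y p) d \<bullet> b" for b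
  proof -
    let ?X = "\<lambda>x. X (chart_inv c x) c" and ?Y = "\<lambda>x. Y (chart_inv c x) c"
    have S: "open ?S" "snd c p \<in> ?S"
      using open_map_domain[OF M N u charts_atD(1)[OF c] d'(1) W] p charts_atD(2)[OF c] d'(2) by auto
    have sm: "smooth_on ?S (local_rep c d u)"
      by (rule smooth_on_subset[OF smooth_map_local_rep[OF u charts_atD(1)[OF c] d'(1)]]) blast
    have sX: "smooth_on ?S ?X" "smooth_on ?S ?Y"
      by (rule smooth_on_subset[OF vector_field_smooth[OF M M smooth_map_id[OF M] _ charts_atD(1)[OF c]]], fact, blast)+
    have inv: "chart_inv c (snd c p) = p" by (rule chart_inv_chart[OF M charts_atD[OF c]])
    have lb: "lie_bracket M X Y p c = frechet_derivative ?Y (at (snd c p)) (X p c)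
        - frechet_derivative ?X (at (snd c p)) (Y p c)"
      using c by (simp add: lie_bracket_def)
    show ?thesis
      using frechet_derivative_bracket[OF S sm sX]
      unfolding dir_deriv_differential_coefficient[OF M N u W X p d c_def]
        dir_deriv_differential_coefficient[OF M N u W Y p d c_def]
        differential_in_chart_at[where u=u and p=p, OF d] c_def[symmetric] lb jac_def inv
      by (simp add: inner_diff_left[symmetric])
  qed
  have "differential M N u p (lie_bracket M X Y p) =
      (\<Sum>b\<in>Basis. tscale (?\<delta> X Y b - ?\<delta> Y X b) (?F b (u p)))"
    unfolding bracket by (rule tangent_frame_expansion[OF N d differential_tangent[OF M N u pM]])
  then show ?thesis
    unfolding expand[OF X Y] expand[OF Y X] frame_torsion_def tscale_diff_left sum_subtractf
    by (simp add: algebra_simps)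
qed

text \<open>A connection is its own pullback under the identity, so the torsion formula for maps
  contains the one for a single manifold.\<close>

lemma induced_connection_id:
  assumes M: "smooth_manifold M" and D: "connection M D"
  shows "induced_connection M M id D D"
  unfolding induced_connection_def using D by (simp add: differential_id[OF M])

text \<open>The case \<open>u = id\<close>. Tangency of the bracket is assumed here instead of being
  derived from a transformation rule; \<open>second_canonical_torsion\<close> supplies it from the
  Levi-Civita connection.\<close>

lemma connection_torsion:
  assumes M: "smooth_manifold M" and D: "connection M D" and W: "openin (mtop M) W"
    and X: "vector_field M W X" and Y: "vector_field M W Y" and p: "p \<in> W"
    and d: "d \<in> charts_at M p" and tangent: "lie_bracket M X Y p \<in> tangent_space M p"
  shows "D p (X p) Y - D p (Y p) X = lie_bracket M X Y p + frame_torsion M D d p (X p) (Y p)"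
proof -
  note id = smooth_map_id[OF M]
  have pM: "q \<in> points M" if "q \<in> W" for q using openin_subset[OF W] that by blast
  have did: "differential M M id q (X q) = X q" if "q \<in> W" "vector_field M W X" for q X
    by (rule differential_id[OF M pM[OF that(1)] vector_field_tangent[OF that(2,1)]])
  have "D p v (\<lambda>q. differential M M id q (X q)) = D p v X"
    if "vector_field M W X" "v \<in> tangent_space M p" for X v
    by (rule connection_cong[OF D W section_along_differential[OF M M id W that(1)] p that(2) that(1)])
       (rule did[OF _ that(1)])
  then have 1: "D p (X p) (\<lambda>q. differential M M id q (Y q)) = D p (X p) Y"
    and 2: "D p (Y p) (\<lambda>q. differential M M id q (X q)) = D p (Y p) X"
    using X Y vector_field_tangent[OF X p] vector_field_tangent[OF Y p] by blast+
  have "d \<in> charts_at M (id p)" using d by simp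
  from induced_connection_torsion[OF M M id induced_connection_id[OF M D] W X Y p this]
  show ?thesis
    unfolding 1 2 did[OF p X] did[OF p Y] differential_id[OF M pM[OF p] tangent]
    unfolding id_apply .
qed

section \<open>Almost Hermitian geometry\<close>

lemma
  assumes "almost_hermitian_manifold M J g" "p \<in> points M" "v \<in> tangent_space M p"
  shows J_tangent: "J p v \<in> tangent_space M p"
    and J_J: "J p (J p v) = - v"
    and J_scale: "J p (tscale r v) = tscale r (J p v)"
    and J_add: "w \<in> tangent_space M p \<Longrightarrow> J p (v + w) = J p v + J p w"
    and J_isometry: "w \<in> tangent_space M p \<Longrightarrow> g p (J p v) (J p w) = g p v w"
    and metric_pos: "v \<noteq> 0 \<Longrightarrow> g p v v > 0"
    and metric_sym: "w \<in> tangent_space M p \<Longrightarrow> g p v w = g p w v"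
    and metric_scale: "w \<in> tangent_space M p \<Longrightarrow> g p (tscale r v) w = r * g p v w"
    and metric_add: "w \<in> tangent_space M p \<Longrightarrow> z \<in> tangent_space M p \<Longrightarrow>
      g p (v + z) w = g p v w + g p z w"
  using assms
  unfolding almost_hermitian_manifold_def almost_complex_structure_def riemannian_metric_def
  by meson+

lemma J_vector_field:
  assumes "almost_hermitian_manifold M J g" "openin (mtop M) W" "vector_field M W X"
  shows "vector_field M W (\<lambda>p. J p (X p))"
proof -
  have "almost_complex_structure M J" using assms(1) by (simp add: almost_hermitian_manifold_def)
  from this[unfolded almost_complex_structure_def, THEN conjunct2, rule_format, OF assms(2,3)]
  show ?thesis .
qed

lemma metric_smooth:
  assumes "almost_hermitian_manifold M J g" "openin (mtop M) W" "vector_field M W X" "vector_field M W Y"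
  shows "smooth_function M W (\<lambda>p. g p (X p) (Y p))"
proof -
  have "riemannian_metric M g" using assms(1) by (simp add: almost_hermitian_manifold_def)
  from this[unfolded riemannian_metric_def, THEN conjunct2, rule_format, OF assms(2-)]
  show ?thesis .
qed

lemma hermitian_smooth_manifold: "almost_hermitian_manifold M J g \<Longrightarrow> smooth_manifold M"
  by (simp add: almost_hermitian_manifold_def)

text \<open>\<open>h\<close> and \<open>- f\<close> are compared on \<open>W\<close> only, because
  the identity to be differentiated, skewness of \<open>J\<close> on two fields, is available only
  where the fields are tangent.\<close>

lemma dir_deriv_minus:
  assumes M: "smooth_manifold M" and W: "openin (mtop M) W" and f: "smooth_function M W f"
    and p: "p \<in> W" and h: "\<And>q. q \<in> W \<Longrightarrow> h q = - f q"
  shows "dir_deriv M p v h = - dir_deriv M p v f"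
proof -
  let ?c = "chart_at M p"
  have c: "?c \<in> charts_at M p" using chart_at_in[OF M] openin_subset[OF W] p by blast
  let ?S = "snd ?c ` (fst ?c \<inter> W)"
  have S: "open ?S" "snd ?c p \<in> ?S"
    using open_chart_image[OF M charts_atD(1)[OF c], of "fst ?c \<inter> W"] chart_openin[OF M charts_atD(1)[OF c]]
      W p charts_atD(2)[OF c] by auto
  have "smooth_on ?S (\<lambda>x. f (chart_inv ?c x))"
    using f charts_atD(1)[OF c] unfolding smooth_function_def by blast
  then have "((\<lambda>x. - f (chart_inv ?c x)) has_derivative
      (\<lambda>v. - frechet_derivative (\<lambda>x. f (chart_inv ?c x)) (at (snd ?c p)) v)) (at (snd ?c p))"
    by (intro has_derivative_minus smooth_on_has_derivative[OF _ S(2)])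
  then have "frechet_derivative (\<lambda>x. - f (chart_inv ?c x)) (at (snd ?c p)) (v ?c) =
      - frechet_derivative (\<lambda>x. f (chart_inv ?c x)) (at (snd ?c p)) (v ?c)"
    by (rule fun_cong[OF frechet_derivative_eqI])
  moreover have "frechet_derivative (\<lambda>x. h (chart_inv ?c x)) (at (snd ?c p)) =
      frechet_derivative (\<lambda>x. - f (chart_inv ?c x)) (at (snd ?c p))"
    by (rule frechet_derivative_cong_open[OF S])
       (use h chart_inv_chart[OF M charts_atD(1)[OF c]] in auto)
  ultimately show ?thesis by (simp add: dir_deriv_def Let_def)
qed

section \<open>Pointwise linear algebra of \<open>J\<close> and \<open>g\<close>\<close>

context
  fixes M :: "('m, 'a::euclidean_space) manifold" and J :: "('m, 'a) endo_field"
    and g :: "('m, 'a) form_field" and p :: 'm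
  assumes H: "almost_hermitian_manifold M J g" and p: "p \<in> points M"
begin

lemma metric_minus:
  assumes "v \<in> tangent_space M p" "w \<in> tangent_space M p"
  shows "g p (- v) w = - g p v w" "g p v (- w) = - g p v w"
proof -
  have l: "g p (- v) w = - g p v w" if "v \<in> tangent_space M p" "w \<in> tangent_space M p" for v w
    using metric_scale[OF H p that, of "-1"] by (simp add: tscale_minus_one)
  show "g p (- v) w = - g p v w" by (rule l[OF assms])
  have "- w \<in> tangent_space M p"
    by (rule tangent_minus[OF hermitian_smooth_manifold[OF H] assms(2)])
  from metric_sym[OF H p assms(1) this] metric_sym[OF H p assms] l[OF assms(2,1)]
  show "g p v (- w) = - g p v w" by simp
qed

lemma metric_diff:
  assumes v: "v \<in> tangent_space M p" and w: "w \<in> tangent_space M p" and z: "z \<in> tangent_space M p"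
  shows "g p (v - w) z = g p v z - g p w z"
  using metric_add[OF H p v z tangent_minus[OF hermitian_smooth_manifold[OF H] w]] metric_minus(1)[OF w z]
  by simp

lemma metric_add_right:
  assumes v: "v \<in> tangent_space M p" and w: "w \<in> tangent_space M p" and z: "z \<in> tangent_space M p"
  shows "g p z (v + w) = g p z v + g p z w"
  using metric_add[OF H p v z w] metric_sym[OF H p _ z] v w tangent_add[OF hermitian_smooth_manifold[OF H] v w]
  by simp

lemma J_skew:
  assumes v: "v \<in> tangent_space M p" and w: "w \<in> tangent_space M p"
  shows "g p (J p v) w = - g p v (J p w)"
proof -
  have "g p (J p v) w = g p (J p (J p v)) (J p w)"
    using J_isometry[OF H p J_tangent[OF H p v] w] by simp
  then show ?thesis
    using J_J[OF H p v] metric_minus(1)[OF v J_tangent[OF H p w]] by simp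
qed

lemma J_minus: "v \<in> tangent_space M p \<Longrightarrow> J p (- v) = - J p v"
  using J_scale[OF H p, of v "-1"] by (simp add: tscale_minus_one)

lemma J_diff:
  assumes "v \<in> tangent_space M p" "w \<in> tangent_space M p"
  shows "J p (v - w) = J p v - J p w"
  using J_add[OF H p assms(1) tangent_minus[OF hermitian_smooth_manifold[OF H] assms(2)]]
    J_minus[OF assms(2)] by simp

lemma J_zero: "J p 0 = 0"
  using J_scale[OF H p tangent_zero[OF hermitian_smooth_manifold[OF H]], of 0] by (simp add: tscale_zero_left)

lemma J_sum:
  assumes "\<And>i. i \<in> I \<Longrightarrow> v i \<in> tangent_space M p"
  shows "J p (\<Sum>i\<in>I. v i) = (\<Sum>i\<in>I. J p (v i))"
  using assms
proof (induction I rule: infinite_finite_induct)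
  case (insert i I)
  have "(\<Sum>i\<in>I. v i) \<in> tangent_space M p"
    by (rule tangent_sum[OF hermitian_smooth_manifold[OF H]]) (use insert.prems in auto)
  then have "J p (v i + (\<Sum>i\<in>I. v i)) = J p (v i) + J p (\<Sum>i\<in>I. v i)"
    by (intro J_add[OF H p]) (use insert.prems in auto)
  then show ?case
    by (simp only: sum.insert[OF insert.hyps] insert.IH[OF insert.prems[OF insertI2]])
qed (simp_all add: J_zero)

text \<open>The second canonical connection is defined by inner products; this turns equalities of
  inner products into equalities of vectors, by testing with \<open>v - w\<close>.\<close>

lemma metric_nondegenerate:
  assumes v: "v \<in> tangent_space M p" and w: "w \<in> tangent_space M p"
    and eq: "\<And>z. z \<in> tangent_space M p \<Longrightarrow> g p v z = g p w z"
  shows "v = w"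
proof (rule ccontr)
  assume "v \<noteq> w"
  have t: "v - w \<in> tangent_space M p" by (rule tangent_diff[OF hermitian_smooth_manifold[OF H] v w])
  have "g p (v - w) (v - w) > 0"
    by (rule metric_pos[OF H p t]) (use \<open>v \<noteq> w\<close> in auto)
  then show False using metric_diff[OF v w t] eq[OF t] by simp
qed

end

lemma coord_field_extends:
  assumes M: "smooth_manifold M" and W: "openin (mtop M) W" and p: "p \<in> W"
    and d: "d \<in> charts_at M p"
  shows "openin (mtop M) (W \<inter> fst d)" "p \<in> W \<inter> fst d" "vector_field M (W \<inter> fst d) (coord_field M d z)"
  using chart_openin[OF M charts_atD(1)[OF d]] W p charts_atD(2)[OF d]
    section_along_subset[OF coord_field_vector_field[OF M charts_atD(1)[OF d], of z], of "W \<inter> fst d"]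
  by auto

text \<open>With \<open>\<alpha> v Y Z = \<langle>(\<nabla>\<^sub>vJ)Y, Z\<rangle>\<close>, the relations \<open>\<alpha> v Y Z = - \<alpha> v Z Y\<close> and
  \<open>\<alpha> v (JY) Z = \<alpha> v Y (JZ)\<close> reduce the required properties of the second canonical connection to
  linear arithmetic.\<close>

context
  fixes M :: "('m, 'a::euclidean_space) manifold" and J :: "('m, 'a) endo_field"
    and g :: "('m, 'a) form_field" and D :: "('m, 'a) conn" and W and p :: 'm
    and \<alpha> and JF
  assumes H: "almost_hermitian_manifold M J g" and D: "levi_civita_connection M g D"
    and W: "openin (mtop M) W" and p: "p \<in> W"
  defines "\<alpha> \<equiv> \<lambda>v Y Z. g p (deriv_endo D J p v Y) (Z p)"
    and "JF \<equiv> \<lambda>X q. J q (X q)"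
begin

lemma lc_point: "q \<in> W \<Longrightarrow> q \<in> points M"
  using openin_subset[OF W] by blast

lemma lc_connection: "connection M D"
  using D by (simp add: levi_civita_connection_def)

lemma lc_torsion_free:
  "vector_field M W X \<Longrightarrow> vector_field M W Y \<Longrightarrow> D p (X p) Y - D p (Y p) X = lie_bracket M X Y p"
  by (rule D[unfolded levi_civita_connection_def, THEN conjunct2, THEN spec, THEN spec, THEN spec,
        THEN mp, OF W, THEN mp, THEN mp, THEN bspec, OF _ _ p, THEN conjunct1])

lemma lc_metric:
  "vector_field M W X \<Longrightarrow> vector_field M W Y \<Longrightarrow> v \<in> tangent_space M p \<Longrightarrow>
    dir_deriv M p v (\<lambda>q. g q (X q) (Y q)) = g p (D p v X) (Y p) + g p (X p) (D p v Y)"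
  by (rule D[unfolded levi_civita_connection_def, THEN conjunct2, THEN spec, THEN spec, THEN spec,
        THEN mp, OF W, THEN mp, THEN mp, THEN bspec, OF _ _ p, THEN conjunct2, THEN bspec])

lemma lc_tangent: "vector_field M W X \<Longrightarrow> v \<in> tangent_space M p \<Longrightarrow> D p v X \<in> tangent_space M p"
  using connection_tangent[OF lc_connection W _ p] by simp

lemma JF_vector_field: "vector_field M W X \<Longrightarrow> vector_field M W (JF X)"
  unfolding JF_def by (rule J_vector_field[OF H W])

lemma deriv_endo_tangent:
  assumes "vector_field M W Y" "v \<in> tangent_space M p"
  shows "deriv_endo D J p v Y \<in> tangent_space M p"
  unfolding deriv_endo_def
  using lc_tangent[OF JF_vector_field[OF assms(1)] assms(2)] lc_tangent[OF assms]
  by (auto simp: JF_def intro: tangent_diff[OF hermitian_smooth_manifold[OF H]] J_tangent[OF H lc_point[OF p]])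

text \<open>Skewness moves \<open>J\<close> from the covariant derivative of \<open>Y\<close> to
  \<open>Z\<close>. Both relations for \<open>\<alpha>\<close> are then read off from this
  form.\<close>

lemma alpha_def_LC:
  assumes Y: "vector_field M W Y" and Z: "vector_field M W Z" and v: "v \<in> tangent_space M p"
  shows "\<alpha> v Y Z = g p (D p v (JF Y)) (Z p) + g p (D p v Y) (JF Z p)"
proof -
  note pM = lc_point[OF p]
  have "\<alpha> v Y Z = g p (D p v (JF Y)) (Z p) - g p (J p (D p v Y)) (Z p)"
    unfolding \<alpha>_def deriv_endo_def JF_def
    by (rule metric_diff[OF H pM lc_tangent[OF JF_vector_field[OF Y, unfolded JF_def] v]
        J_tangent[OF H pM lc_tangent[OF Y v]] vector_field_tangent[OF Z p]])
  then show ?thesis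
    using J_skew[OF H pM lc_tangent[OF Y v] vector_field_tangent[OF Z p]] by (simp add: JF_def)
qed

lemma JF_JF: "vector_field M W X \<Longrightarrow> q \<in> W \<Longrightarrow> JF (JF X) q = - X q"
  unfolding JF_def by (rule J_J[OF H lc_point vector_field_tangent])

lemma lc_JF_JF:
  assumes X: "vector_field M W X" and v: "v \<in> tangent_space M p"
  shows "D p v (JF (JF X)) = - D p v X"
proof -
  note M = hermitian_smooth_manifold[OF H]
  have "D p v (JF (JF X)) = D p v (\<lambda>q. - X q)"
    by (rule connection_cong[OF lc_connection W JF_vector_field[OF JF_vector_field[OF X]] p v
          section_along_minus[OF M M smooth_map_id[OF M] W X] JF_JF[OF X]])
  also have "\<dots> = - D p v X"
    by (rule connection_minus[OF M M smooth_map_id[OF M] lc_connection W X p v])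
  finally show ?thesis .
qed

lemma alpha_minus_dir:
  assumes Y: "vector_field M W Y" and Z: "vector_field M W Z" and X: "vector_field M W X"
  shows "\<alpha> (JF (JF X) p) Y Z = - \<alpha> (X p) Y Z"
proof -
  note pM = lc_point[OF p] and M = hermitian_smooth_manifold[OF H]
  note v = vector_field_tangent[OF X p]
  show ?thesis
    unfolding JF_JF[OF X p] alpha_def_LC[OF Y Z v] alpha_def_LC[OF Y Z tangent_minus[OF M v]]
      connection_minus_dir[OF lc_connection W Y p v] connection_minus_dir[OF lc_connection W JF_vector_field[OF Y] p v]
    using metric_minus(1)[OF H pM lc_tangent[OF Y v] vector_field_tangent[OF JF_vector_field[OF Z] p]]
      metric_minus(1)[OF H pM lc_tangent[OF JF_vector_field[OF Y] v] vector_field_tangent[OF Z p]]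
    by simp
qed

lemma alpha_JJ:
  assumes Y: "vector_field M W Y" and Z: "vector_field M W Z" and v: "v \<in> tangent_space M p"
  shows "\<alpha> v Y (JF (JF Z)) = - \<alpha> v Y Z"
  unfolding \<alpha>_def JF_JF[OF Z p]
  by (rule metric_minus(2)[OF H lc_point[OF p] deriv_endo_tangent[OF Y v] vector_field_tangent[OF Z p]])

text \<open>Both sides equal \<open>g(D_v JY, JZ) - g(D_v Y, Z)\<close>, since
  \<open>JF (JF Y)\<close> is \<open>- Y\<close> on \<open>W\<close>. Invariantly: differentiating
  \<open>J^2 = -1\<close> shows that \<open>J\<close> anticommutes with its covariant
  derivative.\<close>

lemma alpha_J:
  assumes Y: "vector_field M W Y" and Z: "vector_field M W Z" and v: "v \<in> tangent_space M p"
  shows "\<alpha> v (JF Y) Z = \<alpha> v Y (JF Z)"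
  using metric_minus(1)[OF H lc_point[OF p] lc_tangent[OF Y v] vector_field_tangent[OF Z p]]
    metric_minus(2)[OF H lc_point[OF p] lc_tangent[OF Y v] vector_field_tangent[OF Z p]]
  by (simp add: alpha_def_LC[OF JF_vector_field[OF Y] Z v] alpha_def_LC[OF Y JF_vector_field[OF Z] v]
      lc_JF_JF[OF Y v] JF_JF[OF Z p])

text \<open>Differentiates \<open>g(JY, Z) = - g(Y, JZ)\<close>, with metric compatibility expanding
  each side into two terms.\<close>

lemma alpha_skew:
  assumes Y: "vector_field M W Y" and Z: "vector_field M W Z" and v: "v \<in> tangent_space M p"
  shows "\<alpha> v Y Z = - \<alpha> v Z Y"
proof -
  note pM = lc_point[OF p]
  note YJ = JF_vector_field[OF Y] and ZJ = JF_vector_field[OF Z]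
  have "dir_deriv M p v (\<lambda>q. g q (JF Y q) (Z q)) = - dir_deriv M p v (\<lambda>q. g q (Y q) (JF Z q))"
    by (rule dir_deriv_minus[OF hermitian_smooth_manifold[OF H] W metric_smooth[OF H W Y ZJ] p])
       (unfold JF_def, rule J_skew[OF H lc_point vector_field_tangent[OF Y] vector_field_tangent[OF Z]])
  then have "g p (D p v (JF Y)) (Z p) + g p (JF Y p) (D p v Z)
      + g p (D p v Y) (JF Z p) + g p (Y p) (D p v (JF Z)) = 0"
    using lc_metric[OF YJ Z v] lc_metric[OF Y ZJ v] by simp
  then show ?thesis
    using metric_sym[OF H pM vector_field_tangent[OF YJ p] lc_tangent[OF Z v]]
      metric_sym[OF H pM vector_field_tangent[OF Y p] lc_tangent[OF ZJ v]]
    unfolding alpha_def_LC[OF Y Z v] alpha_def_LC[OF Z Y v] by simp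
qed

context
  fixes D'
  assumes C: "\<And>X Y Z. vector_field M W X \<Longrightarrow> vector_field M W Y \<Longrightarrow> vector_field M W Z \<Longrightarrow>
     g p (D' p (X p) Y) (Z p) = g p (D p (X p) Y) (Z p)
       - 1/2 * g p (J p (deriv_endo D J p (X p) Y)) (Z p)
       + 1/4 * (g p (X p) (deriv_endo D J p (J p (Y p)) Z + J p (deriv_endo D J p (Y p) Z))
              - g p (X p) (deriv_endo D J p (J p (Z p)) Y + J p (deriv_endo D J p (Z p) Y)))"
    and C': "connection M D'"
begin

text \<open>Moving an outer \<open>J\<close> to the other argument costs a sign: hence
  \<open>+ 1/2\<close> where the definition has \<open>- 1/2\<close>, and the signs of the two terms
  with \<open>JF X\<close>.\<close>

lemma second_canonical_alpha:
  assumes X: "vector_field M W X" and Y: "vector_field M W Y" and Z: "vector_field M W Z"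
  shows "g p (D' p (X p) Y) (Z p) = g p (D p (X p) Y) (Z p) + 1/2 * \<alpha> (X p) Y (JF Z)
    + 1/4 * (\<alpha> (JF Y p) Z X - \<alpha> (Y p) Z (JF X) - \<alpha> (JF Z p) Y X + \<alpha> (Z p) Y (JF X))"
proof -
  note pM = lc_point[OF p]
  have JA: "g p (J p (deriv_endo D J p (X p) Y)) (Z p) = - \<alpha> (X p) Y (JF Z)"
    if "vector_field M W X" "vector_field M W Y" "vector_field M W Z" for X Y Z
    unfolding \<alpha>_def JF_def
    by (rule J_skew[OF H pM deriv_endo_tangent[OF that(2) vector_field_tangent[OF that(1) p]]
          vector_field_tangent[OF that(3) p]])
  have "g p (X p) (deriv_endo D J p (J p (Y p)) Z + J p (deriv_endo D J p (Y p) Z)) =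
      \<alpha> (JF Y p) Z X - \<alpha> (Y p) Z (JF X)" if Y: "vector_field M W Y" and Z: "vector_field M W Z" for Y Z
  proof -
    note t = deriv_endo_tangent[OF Z vector_field_tangent[OF JF_vector_field[OF Y] p]]
      J_tangent[OF H pM deriv_endo_tangent[OF Z vector_field_tangent[OF Y p]]]
    note x = vector_field_tangent[OF X p]
    have "g p (X p) (deriv_endo D J p (JF Y p) Z + J p (deriv_endo D J p (Y p) Z)) =
        g p (deriv_endo D J p (JF Y p) Z) (X p) + g p (J p (deriv_endo D J p (Y p) Z)) (X p)"
      using metric_add_right[OF H pM t x] metric_sym[OF H pM x t(1)] metric_sym[OF H pM x t(2)] by simp
    then show ?thesis using JA[OF Y Z X] by (simp add: \<alpha>_def JF_def)
  qed
  then show ?thesis using C[OF X Y Z] JA[OF X Y Z] Y Z by simp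
qed

text \<open>By skewness of \<open>J\<close> the claim is that a sum vanishes. Its Levi-Civita terms
  add up to \<open>\<alpha> (X p) Y Z\<close>, the terms with factor 1/2 to the negative of this,
  and the eight terms with factor 1/4 cancel in pairs.\<close>

lemma second_canonical_J_parallel_weak:
  assumes X: "vector_field M W X" and Y: "vector_field M W Y" and Z: "vector_field M W Z"
  shows "g p (D' p (X p) (JF Y)) (Z p) = g p (J p (D' p (X p) Y)) (Z p)"
proof -
  note F = X Y Z JF_vector_field[OF X] JF_vector_field[OF Y] JF_vector_field[OF Z]
  note V = vector_field_tangent[OF X p] vector_field_tangent[OF Y p] vector_field_tangent[OF Z p]
    vector_field_tangent[OF F(4) p] vector_field_tangent[OF F(5) p] vector_field_tangent[OF F(6) p]
  have "D' p (X p) Y \<in> tangent_space M p"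
    using connection_tangent[OF C' W Y p V(1)] by simp
  then have "g p (J p (D' p (X p) Y)) (Z p) = - g p (D' p (X p) Y) (JF Z p)"
    unfolding JF_def using J_skew[OF H lc_point[OF p] _ V(3)] by blast
  moreover have "g p (D' p (X p) (JF Y)) (Z p) + g p (D' p (X p) Y) (JF Z p) = 0"
    unfolding second_canonical_alpha[OF F(1,5,3)] second_canonical_alpha[OF F(1,2,6)]
      alpha_minus_dir[OF Z X Y] alpha_minus_dir[OF Y X Z]
      alpha_J[OF Y F(6) V(1)] alpha_JJ[OF Y Z V(1)] alpha_J[OF Y X V(6)] alpha_J[OF Z X V(5)]
      alpha_J[OF Y F(4) V(3)] alpha_J[OF Z F(4) V(2)] alpha_JJ[OF Y X V(3)] alpha_JJ[OF Z X V(2)]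
    using alpha_def_LC[OF Y Z V(1)] by (simp add: field_simps)
  ultimately show ?thesis by simp
qed

text \<open>The corrections to \<open>D\<close> cancel. Those differentiating in direction
  \<open>Z\<close> or \<open>JZ\<close> cancel between the pairs \<open>X, Y\<close> and
  \<open>JX, JY\<close>. The other terms with factor 1/4 each occur twice, and by
  \<open>alpha_skew\<close> they are then opposite to the terms with factor 1/2.\<close>

lemma second_canonical_torsion_weak:
  assumes X: "vector_field M W X" and Y: "vector_field M W Y" and Z: "vector_field M W Z"
  shows "g p (D' p (X p) Y) (Z p) - g p (D' p (Y p) X) (Z p)
      + (g p (D' p (JF X p) (JF Y)) (Z p) - g p (D' p (JF Y p) (JF X)) (Z p))
    = g p (D p (X p) Y) (Z p) - g p (D p (Y p) X) (Z p)
      + (g p (D p (JF X p) (JF Y)) (Z p) - g p (D p (JF Y p) (JF X)) (Z p))"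
proof -
  note F = X Y Z JF_vector_field[OF X] JF_vector_field[OF Y] JF_vector_field[OF Z]
  note V = vector_field_tangent[OF X p] vector_field_tangent[OF Y p] vector_field_tangent[OF Z p]
    vector_field_tangent[OF F(4) p] vector_field_tangent[OF F(5) p] vector_field_tangent[OF F(6) p]
  show ?thesis
    unfolding second_canonical_alpha[OF F(1,2,3)] second_canonical_alpha[OF F(2,1,3)]
      second_canonical_alpha[OF F(4,5,3)] second_canonical_alpha[OF F(5,4,3)]
      alpha_minus_dir[OF Z F(4) Y] alpha_minus_dir[OF Z F(5) X]
      alpha_J[OF Y F(6) V(4)] alpha_J[OF X F(6) V(5)] alpha_JJ[OF Y Z V(4)] alpha_JJ[OF X Z V(5)]
      alpha_JJ[OF Z X V(5)] alpha_JJ[OF Z Y V(4)]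
      alpha_J[OF Y F(4) V(6)] alpha_J[OF X F(5) V(6)] alpha_JJ[OF Y X V(6)] alpha_JJ[OF X Y V(6)]
      alpha_JJ[OF F(5) X V(3)] alpha_JJ[OF F(4) Y V(3)] alpha_J[OF Y X V(3)] alpha_J[OF X Y V(3)]
      alpha_skew[OF Z X V(5)] alpha_skew[OF Z Y V(4)] alpha_skew[OF Z F(5) V(1)] alpha_skew[OF Z F(4) V(2)]
      alpha_J[OF Y Z V(1)] alpha_J[OF X Z V(2)]
    by (simp add: field_simps)
qed

end

end

section \<open>Parallelism and torsion of the second canonical connection\<close>

lemma second_canonical_connection_D: "second_canonical_connection M J g D' \<Longrightarrow> connection M D'"
  by (simp add: second_canonical_connection_def)

lemma second_canonical_levi_civita:
  assumes "second_canonical_connection M J g D'"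
  obtains D where "levi_civita_connection M g D"
    "\<And>W X Y Z p. openin (mtop M) W \<Longrightarrow> vector_field M W X \<Longrightarrow> vector_field M W Y \<Longrightarrow>
       vector_field M W Z \<Longrightarrow> p \<in> W \<Longrightarrow> g p (D' p (X p) Y) (Z p) = g p (D p (X p) Y) (Z p)
       - 1/2 * g p (J p (deriv_endo D J p (X p) Y)) (Z p)
       + 1/4 * (g p (X p) (deriv_endo D J p (J p (Y p)) Z + J p (deriv_endo D J p (Y p) Z))
              - g p (X p) (deriv_endo D J p (J p (Z p)) Y + J p (deriv_endo D J p (Z p) Y)))"
proof -
  from assms[unfolded second_canonical_connection_def, THEN conjunct2] obtain D where
    D: "levi_civita_connection M g D \<and> (\<forall>W X Y Z. openin (mtop M) W \<longrightarrow>
          vector_field M W X \<longrightarrow> vector_field M W Y \<longrightarrow> vector_field M W Z \<longrightarrow>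
          (\<forall>p\<in>W. g p (D' p (X p) Y) (Z p) = g p (D p (X p) Y) (Z p)
               - 1/2 * g p (J p (deriv_endo D J p (X p) Y)) (Z p)
               + 1/4 * (g p (X p) (deriv_endo D J p (J p (Y p)) Z + J p (deriv_endo D J p (Y p) Z))
                      - g p (X p) (deriv_endo D J p (J p (Z p)) Y + J p (deriv_endo D J p (Z p) Y)))))" ..
  show thesis
    by (rule that[OF D[THEN conjunct1]]) (rule D[THEN conjunct2, rule_format])
qed

text \<open>The direction \<open>v\<close> and a test vector \<open>z\<close> are extended to
  coordinate fields on the smaller open set \<open>W \<inter> fst d\<close>, where the weak form
  applies; nondegeneracy then removes \<open>z\<close>.\<close>

lemma second_canonical_J_parallel:
  assumes H: "almost_hermitian_manifold M J g" and S: "second_canonical_connection M J g D'"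
    and W: "openin (mtop M) W" and Y: "vector_field M W Y" and p: "p \<in> W"
    and v: "v \<in> tangent_space M p"
  shows "D' p v (\<lambda>q. J q (Y q)) = J p (D' p v Y)"
proof -
  note M = hermitian_smooth_manifold[OF H] and C = second_canonical_connection_D[OF S]
  have pM: "p \<in> points M" using openin_subset[OF W] p by blast
  define d where "d = chart_at M p"
  have d: "d \<in> charts_at M p" unfolding d_def by (rule chart_at_in[OF M pM])
  note W' = coord_field_extends[OF M W p d]
  obtain D where D: "levi_civita_connection M g D" and F:
    "\<And>W X Y Z p. openin (mtop M) W \<Longrightarrow> vector_field M W X \<Longrightarrow> vector_field M W Y \<Longrightarrow>
       vector_field M W Z \<Longrightarrow> p \<in> W \<Longrightarrow> g p (D' p (X p) Y) (Z p) = g p (D p (X p) Y) (Z p)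
       - 1/2 * g p (J p (deriv_endo D J p (X p) Y)) (Z p)
       + 1/4 * (g p (X p) (deriv_endo D J p (J p (Y p)) Z + J p (deriv_endo D J p (Y p) Z))
              - g p (X p) (deriv_endo D J p (J p (Z p)) Y + J p (deriv_endo D J p (Z p) Y)))"
    by (rule second_canonical_levi_civita[OF S]) blast
  have Y': "vector_field M (W \<inter> fst d) Y" by (rule section_along_subset[OF Y]) blast
  have t: "D' p v Y \<in> tangent_space M p" if "vector_field M W Y" for Y
    using connection_tangent[OF C W that p v] by simp
  show ?thesis
  proof (rule metric_nondegenerate[OF H pM t[OF J_vector_field[OF H W Y]] J_tangent[OF H pM t[OF Y]]])
    fix z assume z: "z \<in> tangent_space M p"
    let ?X = "coord_field M d (v d)" and ?Z = "coord_field M d (z d)"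
    have "g p (D' p (?X p) (\<lambda>q. J q (Y q))) (?Z p) = g p (J p (D' p (?X p) Y)) (?Z p)"
      by (rule second_canonical_J_parallel_weak[OF H D W'(1,2) _ C W'(3) Y' W'(3)])
         (rule F[OF W'(1) _ _ _ W'(2)])
    then show "g p (D' p v (\<lambda>q. J q (Y q))) z = g p (J p (D' p v Y)) z"
      unfolding coord_field_eq[OF M d v] coord_field_eq[OF M d z] .
  qed
qed

text \<open>The Levi-Civita side of \<open>second_canonical_torsion_weak\<close> consists of
  brackets, by torsion-freeness. For the same reason a bracket is tangent: it is a difference of two
  covariant derivatives.\<close>

lemma second_canonical_torsion:
  assumes H: "almost_hermitian_manifold M J g" and S: "second_canonical_connection M J g D'"
    and W: "openin (mtop M) W" and X: "vector_field M W X" and Y: "vector_field M W Y" and p: "p \<in> W"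
  defines "JX \<equiv> \<lambda>q. J q (X q)" and "JY \<equiv> \<lambda>q. J q (Y q)"
  shows "(D' p (X p) Y - D' p (Y p) X) + (D' p (JX p) JY - D' p (JY p) JX) =
      lie_bracket M X Y p + lie_bracket M JX JY p"
    and "lie_bracket M X Y p \<in> tangent_space M p"
proof -
  note M = hermitian_smooth_manifold[OF H] and C = second_canonical_connection_D[OF S]
  have pM: "p \<in> points M" using openin_subset[OF W] p by blast
  define d where "d = chart_at M p"
  have d: "d \<in> charts_at M p" unfolding d_def by (rule chart_at_in[OF M pM])
  note W' = coord_field_extends[OF M W p d]
  obtain D where D: "levi_civita_connection M g D" and F:
    "\<And>W X Y Z p. openin (mtop M) W \<Longrightarrow> vector_field M W X \<Longrightarrow> vector_field M W Y \<Longrightarrow>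
       vector_field M W Z \<Longrightarrow> p \<in> W \<Longrightarrow> g p (D' p (X p) Y) (Z p) = g p (D p (X p) Y) (Z p)
       - 1/2 * g p (J p (deriv_endo D J p (X p) Y)) (Z p)
       + 1/4 * (g p (X p) (deriv_endo D J p (J p (Y p)) Z + J p (deriv_endo D J p (Y p) Z))
              - g p (X p) (deriv_endo D J p (J p (Z p)) Y + J p (deriv_endo D J p (Z p) Y)))"
    by (rule second_canonical_levi_civita[OF S]) blast
  have JX: "vector_field M W JX" and JY: "vector_field M W JY"
    unfolding JX_def JY_def by (rule J_vector_field[OF H W X], rule J_vector_field[OF H W Y])
  note lc = lc_torsion_free[OF H D W p]
  have t: "D' p (X p) Y \<in> tangent_space M p" "D p (X p) Y \<in> tangent_space M p"
    if "vector_field M W X" "vector_field M W Y" for X Y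
    using connection_tangent[OF C W that(2) p vector_field_tangent[OF that(1) p]]
      lc_tangent[OF H D W p that(2) vector_field_tangent[OF that(1) p]] by simp_all
  note t' = t(1)[OF X Y] t(1)[OF Y X] t(1)[OF JX JY] t(1)[OF JY JX]
  note s' = t(2)[OF X Y] t(2)[OF Y X] t(2)[OF JX JY] t(2)[OF JY JX]
  note td = tangent_diff[OF M] and ta = tangent_add[OF M]
  show "lie_bracket M X Y p \<in> tangent_space M p"
    unfolding lc[OF X Y, symmetric] by (rule td[OF s'(1,2)])
  show "(D' p (X p) Y - D' p (Y p) X) + (D' p (JX p) JY - D' p (JY p) JX) =
      lie_bracket M X Y p + lie_bracket M JX JY p"
    unfolding lc[OF X Y, symmetric] lc[OF JX JY, symmetric]
  proof (rule metric_nondegenerate[OF H pM ta[OF td[OF t'(1,2)] td[OF t'(3,4)]] ta[OF td[OF s'(1,2)] td[OF s'(3,4)]]])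
    fix z assume z: "z \<in> tangent_space M p"
    have X': "vector_field M (W \<inter> fst d) X" and Y': "vector_field M (W \<inter> fst d) Y"
      by (rule section_along_subset, fact, blast)+
    let ?Z = "coord_field M d (z d)"
    have "g p (D' p (X p) Y) (?Z p) - g p (D' p (Y p) X) (?Z p)
        + (g p (D' p (JX p) JY) (?Z p) - g p (D' p (JY p) JX) (?Z p))
      = g p (D p (X p) Y) (?Z p) - g p (D p (Y p) X) (?Z p)
        + (g p (D p (JX p) JY) (?Z p) - g p (D p (JY p) JX) (?Z p))"
      unfolding JX_def JY_def
      by (rule second_canonical_torsion_weak[OF H D W'(1,2) _ C X' Y' W'(3)])
         (rule F[OF W'(1) _ _ _ W'(2)])
    then show "g p ((D' p (X p) Y - D' p (Y p) X) + (D' p (JX p) JY - D' p (JY p) JX)) z =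
        g p ((D p (X p) Y - D p (Y p) X) + (D p (JX p) JY - D p (JY p) JX)) z"
      unfolding coord_field_eq[OF M d z]
        metric_add[OF H pM td[OF t'(1,2)] z td[OF t'(3,4)]] metric_add[OF H pM td[OF s'(1,2)] z td[OF s'(3,4)]]
        metric_diff[OF H pM t'(1,2) z] metric_diff[OF H pM t'(3,4) z]
        metric_diff[OF H pM s'(1,2) z] metric_diff[OF H pM s'(3,4) z] .
  qed
qed

text \<open>\<open>w\<close> and \<open>z\<close> are extended to coordinate fields. Their images
  under \<open>J\<close> need not have constant coordinates, so a bracket remains there; it cancels
  against the one in \<open>second_canonical_torsion\<close>.\<close>

lemma frame_torsion_J:
  assumes H: "almost_hermitian_manifold N J h" and S: "second_canonical_connection N J h D"
    and d: "d \<in> charts_at N q" and w: "w \<in> tangent_space N q" and z: "z \<in> tangent_space N q"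
  shows "frame_torsion N D d q w z + frame_torsion N D d q (J q w) (J q z) = 0"
proof -
  note N = hermitian_smooth_manifold[OF H] and C = second_canonical_connection_D[OF S]
  note d' = charts_atD[OF d] and W = chart_openin[OF N charts_atD(1)[OF d]]
  let ?X = "coord_field N d (w d)" and ?Y = "coord_field N d (z d)"
  let ?JX = "\<lambda>q. J q (?X q)" and ?JY = "\<lambda>q. J q (?Y q)"
  note X = coord_field_vector_field[OF N d'(1), of "w d"] and Y = coord_field_vector_field[OF N d'(1), of "z d"]
  note JX = J_vector_field[OF H W X] and JY = J_vector_field[OF H W Y]
  have Xq: "?X q = w" "?Y q = z" using coord_field_eq[OF N d] w z by auto
  show ?thesis
    using connection_torsion[OF N C W X Y d'(2) d second_canonical_torsion(2)[OF H S W X Y d'(2)]]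
      connection_torsion[OF N C W JX JY d'(2) d second_canonical_torsion(2)[OF H S W JX JY d'(2)]]
      second_canonical_torsion(1)[OF H S W X Y d'(2)]
    unfolding Xq by (simp add: algebra_simps)
qed

text \<open>Parallelism on \<open>N\<close> passes to the pulled-back frame by the chain rule and to
  a general \<open>s\<close> by the Leibniz rule, since \<open>J\<close> is linear over the
  coefficients. Smoothness of \<open>J s\<close> is a hypothesis; for \<open>s = du Y\<close>
  holomorphy provides it.\<close>

lemma induced_connection_J_parallel:
  assumes M: "smooth_manifold M" and H: "almost_hermitian_manifold N J h" and u: "smooth_map M N u"
    and S: "second_canonical_connection N J h D" and E: "induced_connection M N u D E"
    and W: "openin (mtop M) W" and s: "section_along M N u W s" and p: "p \<in> W"
    and v: "v \<in> tangent_space M p"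
    and Js: "section_along M N u W (\<lambda>q. J (u q) (s q))"
  shows "E p v (\<lambda>q. J (u q) (s q)) = J (u p) (E p v s)"
proof -
  note N = hermitian_smooth_manifold[OF H] and C = second_canonical_connection_D[OF S]
  have pM: "q \<in> points M" if "q \<in> W" for q using openin_subset[OF W] that by blast
  note uM = smooth_map_point[OF u pM]
  define d where "d = chart_at N (u p)"
  have d: "d \<in> charts_at N (u p)" unfolding d_def by (rule chart_at_in[OF N uM[OF p]])
  note d' = charts_atD[OF d] and V = chart_openin[OF N charts_atD(1)[OF d]]
  let ?F = "\<lambda>b. coord_field N d b" and ?W = "W \<inter> u -` fst d"
  let ?dv = "differential M N u p v"
  note dv = differential_tangent[OF M N u pM[OF p], of v]
  note F = coord_field_vector_field[OF N d'(1)]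
  note JF = J_vector_field[OF H V F]
  have W': "openin (mtop M) ?W" by (rule openin_map_preimage[OF u W V])
  have pW: "p \<in> ?W" using p d'(2) by simp
  have Fq: "?F b (u q) \<in> tangent_space N (u q)" if "q \<in> ?W" for b q
    using vector_field_tangent[OF F] that by simp
  have exp: "s q = (\<Sum>b\<in>Basis. tscale (s q d \<bullet> b) (?F b (u q)))" if q: "q \<in> ?W" for q
    using q d'(1) by (intro tangent_frame_expansion[OF N _ section_along_tangent[OF s]]) (auto simp: charts_at_def)
  have EF: "E p v (\<lambda>q. ?F b (u q)) = D (u p) ?dv (?F b)" for b
    by (rule induced_connection_chain[OF E V F pM[OF p] d'(2) v])
  \<comment> \<open>\<open>J\<close> applied to a coordinate field is again a vector field on
    \<open>N\<close>, so the chain rule applies on both sides.\<close>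
  have EJF: "E p v (\<lambda>q. J (u q) (?F b (u q))) = J (u p) (E p v (\<lambda>q. ?F b (u q)))" for b
    unfolding EF second_canonical_J_parallel[OF H S V F d'(2) dv, symmetric]
    by (rule induced_connection_chain[OF E V JF pM[OF p] d'(2) v])
  let ?\<delta> = "\<lambda>b. dir_deriv M p v (\<lambda>q. s q d \<bullet> b)"
  have "E p v (\<lambda>q. J (u q) (s q)) =
      (\<Sum>b\<in>Basis. tscale (?\<delta> b) (J (u p) (?F b (u p))) + tscale (s p d \<bullet> b) (E p v (\<lambda>q. J (u q) (?F b (u q)))))"
  proof (rule connection_leibniz_sum[OF M N u induced_connection_along[OF E] W' _ pW v])
    show "section_along M N u ?W (\<lambda>q. J (u q) (s q))" by (rule section_along_subset[OF Js]) blast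
    show "smooth_function M ?W (\<lambda>q. s q d \<bullet> b)" for b
      by (rule section_along_coefficient[OF M N u W s d'(1)])
    show "section_along M N u ?W (\<lambda>q. J (u q) (?F b (u q)))" for b
      by (rule section_along_compose[OF M N u V JF W])
    show "J (u q) (s q) = (\<Sum>b\<in>Basis. tscale (s q d \<bullet> b) (J (u q) (?F b (u q))))" if q: "q \<in> ?W" for q
    proof -
      have uq: "u q \<in> points N" using uM q by blast
      have "J (u q) (s q) = J (u q) (\<Sum>b\<in>Basis. tscale (s q d \<bullet> b) (?F b (u q)))"
        using exp[OF q] by (rule arg_cong)
      also have "\<dots> = (\<Sum>b\<in>Basis. J (u q) (tscale (s q d \<bullet> b) (?F b (u q))))"
        by (rule J_sum[OF H uq tangent_scale[OF N Fq[OF q]]])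
      finally show ?thesis by (simp only: J_scale[OF H uq Fq[OF q]])
    qed
  qed
  also have "\<dots> = (\<Sum>b\<in>Basis. J (u p) (tscale (?\<delta> b) (?F b (u p)) + tscale (s p d \<bullet> b) (E p v (\<lambda>q. ?F b (u q)))))"
  proof (rule sum.cong[OF refl])
    fix b
    have t: "E p v (\<lambda>q. ?F b (u q)) \<in> tangent_space N (u p)"
      unfolding EF using connection_tangent[OF C V F d'(2) dv] by simp
    show "tscale (?\<delta> b) (J (u p) (?F b (u p))) + tscale (s p d \<bullet> b) (E p v (\<lambda>q. J (u q) (?F b (u q)))) =
        J (u p) (tscale (?\<delta> b) (?F b (u p)) + tscale (s p d \<bullet> b) (E p v (\<lambda>q. ?F b (u q))))"
      unfolding EJF J_add[OF H uM[OF p] tangent_scale[OF N Fq[OF pW]] tangent_scale[OF N t]]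
        J_scale[OF H uM[OF p] Fq[OF pW]] J_scale[OF H uM[OF p] t] ..
  qed
  also have "\<dots> = J (u p) (\<Sum>b\<in>Basis. tscale (?\<delta> b) (?F b (u p)) + tscale (s p d \<bullet> b) (E p v (\<lambda>q. ?F b (u q))))"
    unfolding EF
    by (rule J_sum[OF H uM[OF p], symmetric])
       (intro tangent_add[OF N] tangent_scale[OF N] Fq[OF pW]
          connection_tangent[OF C V F d'(2) dv, unfolded id_apply])
  also have "\<dots> = J (u p) (E p v s)"
    by (simp only: connection_frame_expansion[OF M N u induced_connection_along[OF E] W s p v d])
  finally show ?thesis .
qed

section \<open>The second fundamental form of a holomorphic map\<close>

context
  fixes M :: "('m, 'a::euclidean_space) manifold"
    and N :: "('n, 'b::euclidean_space) manifold"
    and J :: "('m, 'a) endo_field" and g :: "('m, 'a) form_field"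
    and J' :: "('n, 'b) endo_field" and h :: "('n, 'b) form_field"
    and u :: "'m \<Rightarrow> 'n" and D D' E W p JF B C
  assumes HM: "almost_hermitian_manifold M J g"
    and HN: "almost_hermitian_manifold N J' h"
    and u: "smooth_map M N u"
    and hol: "holomorphic_map M J N J' u"
    and S: "second_canonical_connection M J g D"
    and S': "second_canonical_connection N J' h D'"
    and E: "induced_connection M N u D' E"
    and W: "openin (mtop M) W" and p: "p \<in> W"
  defines "JF \<equiv> \<lambda>X q. J q (X q)"
    and "B \<equiv> \<lambda>X Y. second_form M N u D E X Y p"
    and "C \<equiv> \<lambda>X Y. B X Y + B (JF X) (JF Y)"
begin

lemmas manifolds = hermitian_smooth_manifold[OF HM] hermitian_smooth_manifold[OF HN]
lemmas connections = second_canonical_connection_D[OF S] induced_connection_along[OF E]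

lemma in_points: "q \<in> W \<Longrightarrow> q \<in> points M"
  using openin_subset[OF W] by blast

lemma JF_field: "vector_field M W X \<Longrightarrow> vector_field M W (JF X)"
  unfolding JF_def by (rule J_vector_field[OF HM W])

lemma connection_value: "vector_field M W X \<Longrightarrow> vector_field M W Y \<Longrightarrow> D p (X p) Y \<in> tangent_space M p"
  using connection_tangent[OF connections(1) W _ p vector_field_tangent] p by simp

lemma differential_section: "vector_field M W Y \<Longrightarrow> section_along M N u W (\<lambda>q. differential M N u q (Y q))"
  by (rule section_along_differential[OF manifolds u W])

lemma differential_J:
  assumes "vector_field M W Y" "q \<in> W"
  shows "differential M N u q (JF Y q) = J' (u q) (differential M N u q (Y q))"
  using hol in_points[OF assms(2)] vector_field_tangent[OF assms] unfolding holomorphic_map_def JF_def by blast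

lemma second_form_tangent:
  assumes X: "vector_field M W X" and Y: "vector_field M W Y"
  shows "B X Y \<in> tangent_space N (u p)"
  unfolding B_def second_form_def
  by (rule tangent_diff[OF manifolds(2)
        connection_tangent[OF connections(2) W differential_section[OF Y] p vector_field_tangent[OF X p]]
        differential_tangent[OF manifolds u in_points[OF p]]])

lemma second_form_J:
  assumes X: "vector_field M W X" and Y: "vector_field M W Y"
  shows "B X (JF Y) = J' (u p) (B X Y)"
proof -
  note x = vector_field_tangent[OF X p] and pM = in_points[OF p]
  note uM = smooth_map_point[OF u pM]
  \<comment> \<open>On \<open>W\<close> this section coincides with the differential of
    \<open>JF Y\<close>, which is already known to be smooth.\<close>
  have s: "section_along M N u W (\<lambda>q. J' (u q) (differential M N u q (Y q)))"
    by (rule section_along_cong[OF manifolds u W differential_section[OF JF_field[OF Y]] differential_J[OF Y]])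
  have "E p (X p) (\<lambda>q. differential M N u q (JF Y q)) = E p (X p) (\<lambda>q. J' (u q) (differential M N u q (Y q)))"
    by (rule connection_cong[OF connections(2) W differential_section[OF JF_field[OF Y]] p x s differential_J[OF Y]])
  also have "\<dots> = J' (u p) (E p (X p) (\<lambda>q. differential M N u q (Y q)))"
    by (rule induced_connection_J_parallel[OF manifolds(1) HN u S' E W differential_section[OF Y] p x s])
  finally have 1: "E p (X p) (\<lambda>q. differential M N u q (JF Y q)) =
      J' (u p) (E p (X p) (\<lambda>q. differential M N u q (Y q)))" .
  have "D p (X p) (JF Y) = J p (D p (X p) Y)"
    unfolding JF_def by (rule second_canonical_J_parallel[OF HM S W Y p x])
  then have 2: "differential M N u p (D p (X p) (JF Y)) = J' (u p) (differential M N u p (D p (X p) Y))"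
    using hol pM connection_value[OF X Y] unfolding holomorphic_map_def by simp
  show ?thesis
    unfolding B_def second_form_def 1 2
    by (rule J_diff[OF HN uM connection_tangent[OF connections(2) W differential_section[OF Y] p x]
          differential_tangent[OF manifolds u pM], symmetric])
qed

text \<open>The first argument enters only through its value at \<open>p\<close>. The hypothesis is
  pointwise so that it covers \<open>JF (JF X)\<close>, known to be \<open>- X\<close> only on
  \<open>W\<close>.\<close>

lemma second_form_minus_left:
  assumes X: "vector_field M W X" and Y: "vector_field M W Y" and X': "X' p = - X p"
  shows "B X' Y = - B X Y"
proof -
  note x = vector_field_tangent[OF X p]
  show ?thesis
    unfolding B_def second_form_def X' connection_minus_dir[OF connections(2) W differential_section[OF Y] p x]
      connection_minus_dir[OF connections(1) W Y p x] differential_minus[OF manifolds(1) u in_points[OF p]]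
    by simp
qed

lemma JF_JF_minus: "vector_field M W X \<Longrightarrow> JF (JF X) p = - X p"
  unfolding JF_def by (rule J_J[OF HM in_points[OF p] vector_field_tangent[OF _ p]])

text \<open>Complex linearity used twice moves the square of \<open>J\<close> to the value in
  \<open>N\<close>, so no second field has to be differentiated again.\<close>

lemma second_form_JJ_right:
  assumes X: "vector_field M W X" and Y: "vector_field M W Y"
  shows "B X (JF (JF Y)) = - B X Y"
  unfolding second_form_J[OF X JF_field[OF Y]] second_form_J[OF X Y]
  by (rule J_J[OF HN smooth_map_point[OF u in_points[OF p]] second_form_tangent[OF X Y]])

lemma second_form_JJ_left:
  "vector_field M W X \<Longrightarrow> vector_field M W Y \<Longrightarrow> B (JF (JF X)) Y = - B X Y"
  by (rule second_form_minus_left) (auto intro: JF_JF_minus)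

text \<open>The first and the last term together are minus the image under \<open>du\<close> of the
  torsion of \<open>D\<close>.\<close>

lemma second_form_skew_part:
  assumes X: "vector_field M W X" and Y: "vector_field M W Y" and d: "d \<in> charts_at N (u p)"
  shows "B X Y - B Y X = differential M N u p (lie_bracket M X Y p)
    + frame_torsion N D' d (u p) (differential M N u p (X p)) (differential M N u p (Y p))
    - differential M N u p (D p (X p) Y - D p (Y p) X)"
  using induced_connection_torsion[OF manifolds u E W X Y p d]
  unfolding B_def second_form_def differential_diff[OF manifolds(1) u in_points[OF p]]
  by (simp add: algebra_simps)

lemma J_invariant_part_symmetric:
  assumes X: "vector_field M W X" and Y: "vector_field M W Y"
  shows "C X Y = C Y X"
proof -
  note pM = in_points[OF p]
  note JX = JF_field[OF X] and JY = JF_field[OF Y]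
  let ?du = "differential M N u p"
  define d where "d = chart_at N (u p)"
  have d: "d \<in> charts_at N (u p)"
    unfolding d_def by (rule chart_at_in[OF manifolds(2) smooth_map_point[OF u pM]])
  have t: "frame_torsion N D' d (u p) (?du (X p)) (?du (Y p))
      + frame_torsion N D' d (u p) (?du (JF X p)) (?du (JF Y p)) = 0"
    unfolding differential_J[OF X p] differential_J[OF Y p]
    by (rule frame_torsion_J[OF HN S' d differential_tangent[OF manifolds u pM] differential_tangent[OF manifolds u pM]])
  have "?du ((D p (X p) Y - D p (Y p) X) + (D p (JF X p) (JF Y) - D p (JF Y p) (JF X))) =
      ?du (lie_bracket M X Y p + lie_bracket M (JF X) (JF Y) p)"
    using second_canonical_torsion(1)[OF HM S W X Y p] unfolding JF_def by simp
  then have "?du (D p (X p) Y - D p (Y p) X) + ?du (D p (JF X p) (JF Y) - D p (JF Y p) (JF X)) =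
      ?du (lie_bracket M X Y p) + ?du (lie_bracket M (JF X) (JF Y) p)"
    unfolding differential_add[OF manifolds(1) u pM] .
  \<comment> \<open>The images of the brackets cancel against those of the covariant derivatives,
    and the two frame torsions against each other by \<open>t\<close>.\<close>
  with t have "(B X Y - B Y X) + (B (JF X) (JF Y) - B (JF Y) (JF X)) = 0"
    unfolding second_form_skew_part[OF X Y d] second_form_skew_part[OF JX JY d]
    by (simp add: algebra_simps)
  then show ?thesis unfolding C_def by (simp add: algebra_simps)
qed

lemma J_invariant_part_zero:
  assumes X: "vector_field M W X" and Y: "vector_field M W Y"
  shows "C X Y = 0"
proof -
  note uM = smooth_map_point[OF u in_points[OF p]]
  note JX = JF_field[OF X] and JY = JF_field[OF Y]
  have lin: "C X (JF Y) = J' (u p) (C X Y)" if X: "vector_field M W X" and Y: "vector_field M W Y" for X Y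
    unfolding C_def second_form_J[OF X Y] second_form_J[OF JF_field[OF X] JF_field[OF Y]]
    by (rule J_add[OF HN uM second_form_tangent[OF X Y] second_form_tangent[OF JF_field[OF X] JF_field[OF Y]], symmetric])
  \<comment> \<open>The two summands of \<open>C\<close> change places; the double \<open>J\<close>
    in each argument gives two signs that cancel.\<close>
  have "C X Y = C (JF X) (JF Y)"
    unfolding C_def second_form_JJ_left[OF X JF_field[OF JY]] second_form_JJ_right[OF X Y] by simp
  also have "\<dots> = J' (u p) (C Y (JF X))"
    unfolding lin[OF JX Y] J_invariant_part_symmetric[OF JX Y] ..
  also have "\<dots> = J' (u p) (J' (u p) (C X Y))"
    unfolding lin[OF Y X] J_invariant_part_symmetric[OF Y X] ..
  also have "\<dots> = - C X Y"
    unfolding C_def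
    by (rule J_J[OF HN uM tangent_add[OF manifolds(2) second_form_tangent[OF X Y] second_form_tangent[OF JX JY]]])
  finally have "C X Y = - C X Y" .
  \<comment> \<open>The conclusion from \<open>C = - C\<close> is drawn in each chart component, a
    Euclidean vector.\<close>
  then have "C X Y d = - C X Y d" for d by (metis uminus_apply)
  then show ?thesis by (auto simp: eq_neg_iff_add_eq_0 simp flip: scaleR_2)
qed

text \<open>For \<open>Z = X - i JX\<close> and conjugate \<open>Y + i JY\<close>, the real part is
  \<open>C X Y\<close>. The imaginary part \<open>B(X, JY) - B(JX, Y)\<close> is
  \<open>C X (JF Y)\<close>, because \<open>B(JX, JJY) = - B(JX, Y)\<close>.\<close>

lemma complex_extension_zero:
  assumes Z: "Z \<in> T10_fields M J W" and V: "V \<in> T10_fields M J W"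
  shows "complex_bilinear_extension (second_form M N u D E) Z (cconj V) p = (0, 0)"
proof -
  obtain X Y where X: "vector_field M W X" and Y: "vector_field M W Y"
    and ZV: "Z = (X, \<lambda>q. - JF X q)" "V = (Y, \<lambda>q. - JF Y q)"
    using Z V unfolding T10_fields_def JF_def by blast
  note JX = JF_field[OF X] and JY = JF_field[OF Y]
  have "complex_bilinear_extension (second_form M N u D E) Z (cconj V) p =
      (B X Y - B (\<lambda>q. - JF X q) (JF Y), B X (JF Y) + B (\<lambda>q. - JF X q) Y)"
    by (simp add: ZV complex_bilinear_extension_def cconj_def B_def)
  also have "\<dots> = (C X Y, C X (JF Y))"
    unfolding C_def second_form_minus_left[OF JX JY, of "\<lambda>q. - JF X q", OF refl]
      second_form_minus_left[OF JX Y, of "\<lambda>q. - JF X q", OF refl]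
      second_form_JJ_right[OF JX Y] by simp
  finally show ?thesis
    using J_invariant_part_zero[OF X Y] J_invariant_part_zero[OF X JY] by simp
qed

end

theorem theorem3p1:
  fixes M :: "('m, 'a::euclidean_space) manifold"
    and N :: "('n, 'b::euclidean_space) manifold"
    and J :: "('m, 'a) endo_field" and g :: "('m, 'a) form_field"
    and J' :: "('n, 'b) endo_field" and h :: "('n, 'b) form_field"
    and u :: "'m \<Rightarrow> 'n"
  assumes "almost_hermitian_manifold M J g"
    and "almost_hermitian_manifold N J' h"
    and "smooth_map M N u"
    and "holomorphic_map M J N J' u"
  shows "hermitian_pluriharmonic M J g N J' h u"
  unfolding hermitian_pluriharmonic_def
  by (intro allI impI ballI) (rule complex_extension_zero[OF assms])

end
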